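(* Let $D=D(0,1)\subset\mathbb{R}^2$ be the open unit disc and let $f\in\mathcal{S}$. Then: (1) $f$ is a radial function. (2) $f$ is strictly monotone decreasing with respect to $r=\sqrt{x^2+y^2}$. (3) $f$ is non-negative. (4) For $(x,y)\in\overline{D}$, $f(x,y)=0$ if and only if $x^2+y^2=1$. (5) For $(x,y)\in D$, if $|\nabla f|_{(x,y)}=0$ then $(x,y)=(0,0)$.
   Context: $C^3_0(D)$ is the space of continuous functions $f:\overline{D}\to\mathbb{R}$ that are $C^3$ on $D$ and vanish on $\partial D$. $H_f$ is the Hessian of $f$, $\|\cdot\|$ the operator norm with respect to the Euclidean norm, and $d\sigma$ Lebesgue (area) measure. $\mathcal{S}\subseteq C^3_0(D)$ is the set of all non-constant $f\in C^3_0(D)$ with $f(0,0)=1$ satisfying $$\max_{D}|f|=\frac{1}{2\pi}\int_{D}\|H_f\|\,d\sigma .$$ *)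

theory Defs
  imports "HOL-Analysis.Analysis"
begin

text \<open>
  Functions on subsets of the plane are total functions on \<open>real^2\<close>, of which only the values
  on \<open>closure D\<close> matter; derivatives are only taken on the open set \<open>D\<close>.
\<close>

definition partial_deriv :: "2 \<Rightarrow> (real^2 \<Rightarrow> real) \<Rightarrow> real^2 \<Rightarrow> real"
  where "partial_deriv i f p = frechet_derivative f (at p) (axis i 1)"

definition gradient :: "(real^2 \<Rightarrow> real) \<Rightarrow> real^2 \<Rightarrow> real^2"
  where "gradient f p = (\<chi> i. partial_deriv i f p)"

definition Hessian :: "(real^2 \<Rightarrow> real) \<Rightarrow> real^2 \<Rightarrow> real^2^2"
  where "Hessian f p = (\<chi> i j. partial_deriv i (partial_deriv j f) p)"

definition Hessian_norm :: "(real^2 \<Rightarrow> real) \<Rightarrow> real^2 \<Rightarrow> real"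
  where "Hessian_norm f p = onorm (\<lambda>v. Hessian f p *v v)"

text \<open>\<open>C_k_on k D f\<close>: \<open>f\<close> is \<open>k\<close> times continuously differentiable on the open set \<open>D\<close>.\<close>

fun C_k_on :: "nat \<Rightarrow> (real^2) set \<Rightarrow> (real^2 \<Rightarrow> real) \<Rightarrow> bool"
  where
    "C_k_on 0 D f \<longleftrightarrow> continuous_on D f"
  | "C_k_on (Suc k) D f \<longleftrightarrow>
       (\<forall>p\<in>D. f differentiable (at p)) \<and> (\<forall>i. C_k_on k D (partial_deriv i f))"

definition C3_0 :: "(real^2) set \<Rightarrow> (real^2 \<Rightarrow> real) set"
  where "C3_0 D = {f. continuous_on (closure D) f \<and> C_k_on 3 D f \<and> (\<forall>p\<in>frontier D. f p = 0)}"

text \<open>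
  For bounded nonempty \<open>D\<close> and \<open>f \<in> C3_0 D\<close> the supremum below is an attained maximum.
  Integrability is required explicitly because the Bochner integral of a non-integrable function
  is \<open>0\<close>, whereas the integral of the non-negative \<open>Hessian_norm f\<close> should then be infinite.
\<close>

definition extremal_set :: "(real^2) set \<Rightarrow> (real^2 \<Rightarrow> real) set"
  where "extremal_set D =
    {f \<in> C3_0 D. \<not> f constant_on closure D \<and> f 0 = 1 \<and>
       set_integrable lebesgue D (Hessian_norm f) \<and>
       (SUP p\<in>D. \<bar>f p\<bar>) = 1 / (2 * pi) * (LINT p:D|lebesgue. Hessian_norm f p)}"

end

theory Submission imports Defs begin

text \<open>
  Write \<open>n\<close> for the direction of \<open>\<nabla>f\<close> and \<open>t\<close> for the unit vector perpendicular to it. The key is the sharp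
  inequality \<open>2 \<pi> f(p) \<le> \<integral> |H(t,t)|\<close> for a function vanishing on the unit circle with \<open>f(p) > 0\<close>.
  Given a unit vector \<open>\<theta>\<close> and a level \<open>c\<close> between \<open>0\<close> and \<open>f(p)\<close>, move the line orthogonal to
  \<open>\<theta>\<close> in from infinity until it first touches \<open>{f \<ge> c}\<close>. At the point \<open>x\<close> of first contact \<open>f(x) = c\<close>,
  \<open>\<nabla>f(x)\<close> is a nonpositive multiple of \<open>\<theta>\<close>, and \<open>f \<le> f(x)\<close> everywhere beyond the line. The
  levels for which \<open>x\<close> can be critical are negligible, for each \<open>\<theta>\<close>
  (\<open>negligible_critical_support_levels\<close>). Hence the map sending a
  point to the direction of its gradient and to its level covers, up to a null set, a cylinder of area
  \<open>2 \<pi> f(p)\<close>; its Jacobian is \<open>|H(t,t)|\<close>, and only contact points are needed to cover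
  (\<open>contact_half_lower_bound\<close>).

  Since \<open>|H(t,t)| \<le> \<parallel>H\<parallel>\<close>, a function for which \<open>\<integral> \<parallel>H\<parallel> \<le> 2 \<pi> f(p)\<close> has equality throughout. So
  almost everywhere either \<open>H = 0\<close>, or the point is a contact point and \<open>\<parallel>H\<parallel> = |H(t,t)|\<close>. By continuity \<open>H\<close> is
  diagonal in the frame \<open>(n,t)\<close> with \<open>|H(n,n)| \<le> |H(t,t)|\<close> (\<open>Hessian_aligned\<close>), and every noncritical
  point is a contact point (\<open>regular_contact\<close>). Contact forces \<open>f \<ge> 0\<close>; applied to \<open>-f\<close> this shows
  that the maximum of \<open>|f|\<close> is a maximum of \<open>f\<close>, because \<open>f(0) = 1\<close>.

  Because \<open>H(n,t) = 0\<close>, the gradient lines are straight. Contact makes the curvature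
  \<open>\<kappa> = -H(t,t)/|\<nabla>f|\<close> of the level lines nonnegative, and along a straight gradient line \<open>\<kappa>\<close> cannot
  increase in the downhill direction, since nearby gradient lines fan out. As
  \<open>|H(n,n)| \<le> \<kappa> |\<nabla>f|\<close>, Gronwall's inequality keeps \<open>|\<nabla>f|\<close> away from \<open>0\<close>, so that each downhill
  ray runs through noncritical points to the unit circle (\<open>regular_downhill\<close>). Contact along the ray makes \<open>f\<close>
  vanish beyond the orthogonal line through the exit point, and no other ray can enter that cap. If a ray
  met the circle obliquely, this would lock the exit points of all nearby rays to the same point, and
  level lines would bend the wrong way (\<open>exit_point_perpendicular\<close>). So all rays are radial, \<open>\<nabla>f(x)\<close> is
  parallel to \<open>x\<close>, and \<open>f\<close> is radial.

  For a radial function \<open>f(x) = \<phi>(|x|)\<close> the inequality \<open>|H(n,n)| \<le> |H(t,t)|\<close> reads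
  \<open>|\<phi>''| \<le> |\<phi>'|/r\<close>. By Gronwall again \<open>\<phi>'\<close> vanishes either nowhere on the open interval from \<open>0\<close> to \<open>1\<close> or
  everywhere, and the latter is excluded by \<open>f(p) > 0\<close>.
\<close>

section \<open>Vector algebra in the plane\<close>

definition perp :: "real^2 \<Rightarrow> real^2" where "perp v = vector [- v $ 2, v $ 1]"

lemma perp_nth [simp]: "perp v $ 1 = - v $ 2" "perp v $ 2 = v $ 1"
  by (simp_all add: perp_def)

lemma inner_real2: "(v :: real^2) \<bullet> w = v $ 1 * w $ 1 + v $ 2 * w $ 2"
  by (simp add: inner_vec_def sum_2)

lemma vec_eq_real2: "(v :: real^2) = w \<longleftrightarrow> v $ 1 = w $ 1 \<and> v $ 2 = w $ 2"
  by (simp add: vec_eq_iff forall_2)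

lemma matrix_vector_real2:
  "((A :: real^2^2) *v v) $ i = A $ i $ 1 * v $ 1 + A $ i $ 2 * v $ 2"
  "(v v* (A :: real^2^2)) $ j = v $ 1 * A $ 1 $ j + v $ 2 * A $ 2 $ j"
  by (simp_all add: matrix_vector_mult_def vector_matrix_mult_def sum_2 mult.commute)

lemmas real2_simps = inner_real2 vec_eq_real2 matrix_vector_real2

lemma inner_perp [simp]: "perp v \<bullet> v = 0" "v \<bullet> perp v = 0" "perp v \<bullet> perp w = v \<bullet> w"
  by (simp_all add: real2_simps)

lemma norm_perp [simp]: "norm (perp v) = norm v"
  by (simp add: norm_eq_sqrt_inner)

lemma perp_decomp: "(w \<bullet> w) *\<^sub>R v = (v \<bullet> w) *\<^sub>R w + (v \<bullet> perp w) *\<^sub>R perp w"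
  by (simp add: real2_simps algebra_simps)

lemma bounded_linear_perp: "bounded_linear perp"
  by (simp add: linear_conv_bounded_linear[symmetric]) (auto intro!: linearI simp: real2_simps)

lemma perp_perp [simp]: "perp (perp v) = - v"
  by (simp add: real2_simps)

lemma perp_scaleR: "perp (c *\<^sub>R v) = c *\<^sub>R perp v"
  by (simp add: real2_simps)

lemma eq_rotation_of_equal_norm:
  fixes x y :: "real^2"
  assumes "norm x = norm y"
  obtains t where "y = cos t *\<^sub>R x + sin t *\<^sub>R perp x"
proof (cases "x = 0")
  case True
  then have "y = 0" using assms by simp
  then show ?thesis using that[of 0] True by simp
next
  case False
  then have xx: "0 < x \<bullet> x" by simp
  define c s where "c = (y \<bullet> x) / (x \<bullet> x)" and "s = (y \<bullet> perp x) / (x \<bullet> x)"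
  have "(x \<bullet> x) *\<^sub>R y = (x \<bullet> x) *\<^sub>R (c *\<^sub>R x + s *\<^sub>R perp x)"
    using perp_decomp[of x y] xx by (simp add: c_def s_def scaleR_add_right)
  then have y: "y = c *\<^sub>R x + s *\<^sub>R perp x" using xx by (simp only: scaleR_cancel_left) auto
  have "y \<bullet> y = (c\<^sup>2 + s\<^sup>2) * (x \<bullet> x)" unfolding y by (simp add: inner_simps power2_eq_square algebra_simps)
  moreover have "y \<bullet> y = x \<bullet> x" using assms by (simp add: norm_eq)
  ultimately have "c\<^sup>2 + s\<^sup>2 = 1" using xx by simp
  then obtain t where "c = cos t" "s = sin t" using sincos_total_2pi[of c s] by metis
  then show ?thesis using that y by simp
qed

section \<open>Rays in the unit ball and one-variable estimates\<close>

text \<open>The larger root of \<open>norm (x + s *\<^sub>R e) = 1\<close> for a unit vector \<open>e\<close>.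
  The explicit formula makes continuity in \<open>x\<close> and \<open>e\<close> evident.\<close>
definition exit_time :: "'a::real_inner \<Rightarrow> 'a \<Rightarrow> real" where
  "exit_time x e = - (x \<bullet> e) + sqrt ((x \<bullet> e)\<^sup>2 + 1 - x \<bullet> x)"

lemma exit_time:
  assumes x: "norm x < 1" and e: "norm e = 1"
  shows "0 < exit_time x e" and "norm (x + exit_time x e *\<^sub>R e) = 1"
    and "\<And>s. 0 \<le> s \<Longrightarrow> norm (x + s *\<^sub>R e) < 1 \<longleftrightarrow> s < exit_time x e"
proof -
  let ?c = "x \<bullet> e" and ?d = "1 - x \<bullet> x"
  have d: "0 < ?d" using power_strict_mono[OF x, of 2] by (simp add: power2_norm_eq_inner)
  have ee: "e \<bullet> e = 1" using e by (simp add: dot_square_norm)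
  define R where "R = sqrt (?c\<^sup>2 + ?d)"
  have R: "R\<^sup>2 = ?c\<^sup>2 + ?d" "\<bar>?c\<bar> < R"
    using d unfolding R_def by (auto simp: real_less_rsqrt)
  have T: "exit_time x e = R - ?c" unfolding exit_time_def R_def by (simp add: algebra_simps)
  have sq: "(norm (x + s *\<^sub>R e))\<^sup>2 = 1 + ((s + ?c)\<^sup>2 - R\<^sup>2)" for s
    unfolding power2_norm_eq_inner R(1)
    by (simp add: inner_simps ee inner_commute[of e x] power2_eq_square algebra_simps)
  show pos: "0 < exit_time x e" using R(2) unfolding T by linarith
  have "(norm (x + exit_time x e *\<^sub>R e))\<^sup>2 = 1" unfolding sq T by simp
  then show "norm (x + exit_time x e *\<^sub>R e) = 1" by (simp add: power2_eq_1_iff) (smt (verit) norm_ge_zero)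
  show "norm (x + s *\<^sub>R e) < 1 \<longleftrightarrow> s < exit_time x e" if "0 \<le> s" for s
  proof -
    have "norm (x + s *\<^sub>R e) < 1 \<longleftrightarrow> (norm (x + s *\<^sub>R e))\<^sup>2 < 1\<^sup>2"
      by (metis abs_norm_cancel abs_one abs_square_less_1 one_power2 power_one)
    also have "\<dots> \<longleftrightarrow> (s + ?c)\<^sup>2 < R\<^sup>2" unfolding sq by simp
    also have "\<dots> \<longleftrightarrow> \<bar>s + ?c\<bar> < \<bar>R\<bar>" by (metis abs_le_square_iff not_le)
    also have "\<dots> \<longleftrightarrow> s < R - ?c" using R(2) that by linarith
    finally show ?thesis unfolding T .
  qed
qed

lemma le_at_right_end:
  fixes \<phi> :: "real \<Rightarrow> real"
  assumes "continuous_on {a..b} \<phi>" "a < b" "\<And>s. a < s \<Longrightarrow> s < b \<Longrightarrow> \<phi> s \<le> c"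
  shows "\<phi> b \<le> c"
  by (rule continuous_le_on_closure[of "{a<..<b}" \<phi>]) (use assms in auto)

lemma first_exit:
  fixes y :: "real \<Rightarrow> 'a::topological_space"
  assumes "open W" "continuous_on {0..b} y" "0 \<le> b" "y b \<notin> W" "y 0 \<in> W"
  obtains s where "0 < s" "s \<le> b" "y s \<notin> W" "\<And>r. 0 \<le> r \<Longrightarrow> r < s \<Longrightarrow> y r \<in> W"
proof -
  let ?B = "{0..b} \<inter> y -` (- W)"
  have "closed ?B" using assms by (intro continuous_closed_preimage) auto
  moreover have "b \<in> ?B" using assms by auto
  moreover have "bdd_below ?B" by (rule bdd_belowI[of _ 0]) auto
  ultimately have mem: "Inf ?B \<in> ?B" by (intro closed_contains_Inf) auto
  moreover have "Inf ?B \<noteq> 0" using mem assms by auto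
  moreover have "y r \<in> W" if "0 \<le> r" "r < Inf ?B" for r
  proof (rule ccontr)
    assume "y r \<notin> W"
    then have "r \<in> ?B" using that mem by auto
    then have "Inf ?B \<le> r" by (intro cInf_lower) (auto intro: bdd_belowI[of _ 0])
    then show False using that by simp
  qed
  ultimately show ?thesis by (intro that[of "Inf ?B"]) auto
qed

text \<open>Both \<open>q\<^sup>2 exp(-2Cs)\<close> and \<open>-q\<^sup>2 exp(2Cs)\<close> are nonincreasing.
  Working with squares lets \<open>q\<close> change sign.\<close>
lemma gronwall_squares:
  fixes q q' :: "real \<Rightarrow> real"
  assumes "0 \<le> a" and der: "\<And>s. 0 \<le> s \<Longrightarrow> s \<le> a \<Longrightarrow> (q has_real_derivative q' s) (at s)"
    and bound: "\<And>s. 0 \<le> s \<Longrightarrow> s \<le> a \<Longrightarrow> \<bar>q' s\<bar> \<le> C * \<bar>q s\<bar>"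
  shows "(q a)\<^sup>2 \<le> (q 0)\<^sup>2 * exp (2 * C * a)" and "(q 0)\<^sup>2 \<le> (q a)\<^sup>2 * exp (2 * C * a)"
proof -
  have key: "\<bar>q s * q' s\<bar> \<le> C * (q s)\<^sup>2" if "0 \<le> s" "s \<le> a" for s
  proof -
    have "\<bar>q s\<bar> * \<bar>q' s\<bar> \<le> \<bar>q s\<bar> * (C * \<bar>q s\<bar>)" by (intro mult_left_mono bound that) auto
    then show ?thesis by (simp add: abs_mult power2_eq_square mult_ac)
  qed
  have "(q a)\<^sup>2 * exp (- (2 * C) * a) \<le> (q 0)\<^sup>2 * exp (- (2 * C) * 0)"
  proof (rule DERIV_nonpos_imp_nonincreasing[OF \<open>0 \<le> a\<close>])
    fix s assume s: "0 \<le> s" "s \<le> a"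
    have "((\<lambda>s. (q s)\<^sup>2 * exp (- (2 * C) * s)) has_real_derivative
       2 * (q s * q' s - C * (q s)\<^sup>2) * exp (- (2 * C) * s)) (at s)"
      by (auto intro!: derivative_eq_intros der s simp: algebra_simps)
    moreover have "2 * (q s * q' s - C * (q s)\<^sup>2) * exp (- (2 * C) * s) \<le> 0"
      using key[OF s] by (simp add: mult_le_0_iff abs_le_iff)
    ultimately show "\<exists>y. ((\<lambda>s. (q s)\<^sup>2 * exp (- (2 * C) * s)) has_real_derivative y) (at s) \<and> y \<le> 0" by blast
  qed
  then show "(q a)\<^sup>2 \<le> (q 0)\<^sup>2 * exp (2 * C * a)" by (simp add: exp_minus field_simps)
  have "(q 0)\<^sup>2 * exp ((2 * C) * 0) \<le> (q a)\<^sup>2 * exp ((2 * C) * a)"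
  proof (rule DERIV_nonneg_imp_nondecreasing[OF \<open>0 \<le> a\<close>])
    fix s assume s: "0 \<le> s" "s \<le> a"
    have "((\<lambda>s. (q s)\<^sup>2 * exp ((2 * C) * s)) has_real_derivative
       2 * (q s * q' s + C * (q s)\<^sup>2) * exp ((2 * C) * s)) (at s)"
      by (auto intro!: derivative_eq_intros der s simp: algebra_simps)
    moreover have "0 \<le> 2 * (q s * q' s + C * (q s)\<^sup>2) * exp ((2 * C) * s)"
      using key[OF s] by (simp add: zero_le_mult_iff abs_le_iff)
    ultimately show "\<exists>y. ((\<lambda>s. (q s)\<^sup>2 * exp ((2 * C) * s)) has_real_derivative y) (at s) \<and> 0 \<le> y" by blast
  qed
  then show "(q 0)\<^sup>2 \<le> (q a)\<^sup>2 * exp (2 * C * a)" by simp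
qed

text \<open>The set where \<open>\<phi>\<close> is positive is open, and a nonempty open set is not
  negligible.\<close>
lemma nonpos_if_AE_nonpos:
  fixes \<phi> :: "'a::euclidean_space \<Rightarrow> real"
  assumes "open W" "continuous_on W \<phi>" "AE x in lebesgue. x \<in> W \<longrightarrow> \<phi> x \<le> 0" "x \<in> W"
  shows "\<phi> x \<le> 0"
proof (rule ccontr)
  assume pos: "\<not> \<phi> x \<le> 0"
  let ?V = "W \<inter> \<phi> -` {0<..}"
  have "open ?V" using assms(1,2) by (intro continuous_open_preimage) auto
  moreover have "?V \<noteq> {}" using pos assms(4) by auto
  ultimately have "\<not> negligible ?V" by (rule open_not_negligible)
  moreover obtain N where N: "{x \<in> space lebesgue. \<not> (x \<in> W \<longrightarrow> \<phi> x \<le> 0)} \<subseteq> N" "N \<in> null_sets lebesgue"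
    using assms(3) by (auto elim!: AE_E simp: null_sets_def)
  ultimately show False using negligible_subset[of N ?V] by (force simp: negligible_iff_null_sets)
qed

section \<open>Null sets and integrals in the plane\<close>

text \<open>Cutting the range of \<open>\<sigma>\<close> into cells of size \<open>1/n\<close> covers
  \<open>B\<close> by order \<open>n\<close> intervals of length of order \<open>1/n\<^sup>2\<close>. This
  replaces Sard's theorem: \<open>B\<close> will be a set of critical values, indexed by a coordinate of the
  critical points.\<close>
lemma negligible_quadratic_index:
  fixes B :: "real set" and \<sigma> :: "real \<Rightarrow> real"
  assumes bdd: "\<And>c. c \<in> B \<Longrightarrow> \<bar>\<sigma> c\<bar> \<le> 1" and "0 < \<eta>" "0 < K"
    and quad: "\<And>c c'. c \<in> B \<Longrightarrow> c' \<in> B \<Longrightarrow> \<bar>\<sigma> c - \<sigma> c'\<bar> < \<eta> \<Longrightarrow> \<bar>c - c'\<bar> \<le> K * (\<sigma> c - \<sigma> c')\<^sup>2"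
  shows "negligible B"
  unfolding negligible_outer_le
proof (intro allI impI)
  fix e :: real assume "e > 0"
  obtain n :: nat where n: "real n > max (1 / \<eta>) (max 1 (6 * K / e))"
    using reals_Archimedean2 by blast
  then have n1: "real n > 1" "1 / \<eta> < real n" "6 * K / e < real n" by auto
  define cell where "cell c = nat \<lfloor>(\<sigma> c + 1) * n\<rfloor>" for c
  have cell_le: "cell c \<le> 2 * n" if "c \<in> B" for c
  proof -
    have "(\<sigma> c + 1) * real n \<le> 2 * real n" using bdd[OF that] by (intro mult_right_mono) auto
    then have "\<lfloor>(\<sigma> c + 1) * n\<rfloor> \<le> \<lfloor>2 * real n\<rfloor>" by (intro floor_mono) simp
    also have "\<lfloor>2 * real n\<rfloor> = 2 * int n" by (metis floor_of_nat mult.commute of_nat_mult of_nat_numeral)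
    finally show ?thesis unfolding cell_def by linarith
  qed
  have near: "\<bar>\<sigma> c - \<sigma> c'\<bar> < 1 / n" if "c \<in> B" "c' \<in> B" "cell c = cell c'" for c c'
  proof -
    have "0 \<le> (\<sigma> c + 1) * n" "0 \<le> (\<sigma> c' + 1) * n" using bdd[OF that(1)] bdd[OF that(2)] by auto
    then have "\<lfloor>(\<sigma> c + 1) * n\<rfloor> = \<lfloor>(\<sigma> c' + 1) * n\<rfloor>" using that(3) unfolding cell_def
      by (subst (asm) eq_nat_nat_iff) auto
    then have "\<bar>(\<sigma> c + 1) * n - (\<sigma> c' + 1) * n\<bar> < 1" by linarith
    then have "\<bar>(\<sigma> c - \<sigma> c') * n\<bar> < 1" by (simp add: algebra_simps)
    then have "\<bar>\<sigma> c - \<sigma> c'\<bar> * n < 1" by (simp add: abs_mult)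
    then show ?thesis using n1(1) by (simp add: field_simps)
  qed
  define r where "r = K / (real n)\<^sup>2"
  have "r \<ge> 0" unfolding r_def using \<open>0 < K\<close> by simp
  have close: "\<bar>c - c'\<bar> \<le> r" if "c \<in> B" "c' \<in> B" "cell c = cell c'" for c c'
  proof -
    have lt: "\<bar>\<sigma> c - \<sigma> c'\<bar> < 1 / n" by (rule near[OF that])
    also have "\<dots> < \<eta>" using n1 \<open>0 < \<eta>\<close> by (simp add: field_simps)
    finally have "\<bar>c - c'\<bar> \<le> K * (\<sigma> c - \<sigma> c')\<^sup>2" by (rule quad[OF that(1,2)])
    also have "(\<sigma> c - \<sigma> c')\<^sup>2 \<le> (1 / n)\<^sup>2" using lt by (intro power2_le_iff_abs_le[THEN iffD2]) auto
    then have "K * (\<sigma> c - \<sigma> c')\<^sup>2 \<le> r" unfolding r_def using \<open>0 < K\<close> mult_left_mono[of "(\<sigma> c - \<sigma> c')\<^sup>2" "(1 / n)\<^sup>2" K]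
      by (simp add: power_divide mult.commute)
    finally show ?thesis .
  qed
  define pick where "pick i = (SOME c. c \<in> B \<and> cell c = i)" for i
  define T where "T = (\<Union>i\<le>2*n. {pick i - r..pick i + r})"
  have "B \<subseteq> T"
  proof
    fix c assume c: "c \<in> B"
    then have "pick (cell c) \<in> B \<and> cell (pick (cell c)) = cell c"
      unfolding pick_def by (intro someI[of "\<lambda>d. d \<in> B \<and> cell d = cell c" c]) simp
    then have "\<bar>c - pick (cell c)\<bar> \<le> r" using close c by auto
    then show "c \<in> T" unfolding T_def using cell_le[OF c]
      by (intro UN_I[of "cell c"]) auto
  qed
  moreover have "T \<in> lmeasurable" unfolding T_def by (intro fmeasurable.finite_UN) auto
  moreover have "measure lebesgue T \<le> e"
  proof -
    have "measure lebesgue T \<le> (\<Sum>i\<le>2*n. measure lebesgue {pick i - r..pick i + r})"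
      unfolding T_def by (intro measure_UNION_le) auto
    also have "\<dots> = (2 * n + 1) * (2 * r)" using \<open>r \<ge> 0\<close> by simp
    also have "\<dots> \<le> 6 * n * r"
      using mult_right_mono[of 2 "2 * real n" r] n1 \<open>r \<ge> 0\<close> by (simp add: algebra_simps)
    also have "\<dots> = 6 * K / n" unfolding r_def using n1 by (simp add: power2_eq_square)
    also have "\<dots> \<le> e" using n1 \<open>e > 0\<close> by (simp add: field_simps)
    finally show ?thesis .
  qed
  ultimately show "\<exists>T. B \<subseteq> T \<and> T \<in> lmeasurable \<and> measure lebesgue T \<le> e" by blast
qed
lemma continuous_on_vector_2:
  fixes a b :: "'a::topological_space \<Rightarrow> real"
  assumes "continuous_on S a" "continuous_on S b"
  shows "continuous_on S (\<lambda>x. vector [a x, b x] :: real^2)"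
proof -
  have "(\<lambda>x. vector [a x, b x] :: real^2) = (\<lambda>x. \<chi> i. if i = 1 then a x else b x)"
    by (auto simp: vec_eq_iff forall_2)
  moreover have "continuous_on S (\<lambda>x. \<chi> i::2. if i = 1 then a x else b x)"
  proof (intro continuous_on_vec_lambda)
    show "continuous_on S (\<lambda>x. if i = 1 then a x else b x)" for i :: 2
      using assms by (cases "i = 1") auto
  qed
  ultimately show ?thesis by (simp only:)
qed

lemma measurable_vector_2 [measurable]:
  "(\<lambda>p. vector [fst p, snd p] :: real^2) \<in> borel_measurable (borel \<Otimes>\<^sub>M borel)"
proof -
  have "continuous_on UNIV (\<lambda>p :: real \<times> real. vector [fst p, snd p] :: real^2)"
    by (intro continuous_on_vector_2 continuous_intros)
  then show ?thesis by (simp add: borel_prod borel_measurable_continuous_onI)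
qed

text \<open>The change of variables theorem concerns \<open>real^2\<close>, Tonelli's theorem the type of pairs; this lemma
  passes from one to the other.\<close>
lemma lborel_real2_eq_distr: "lborel = distr (lborel \<Otimes>\<^sub>M lborel) borel (\<lambda>p. vector [fst p, snd p] :: real^2)"
proof (rule lborel_eqI)
  have meas: "(\<lambda>p. vector [fst p, snd p] :: real^2) \<in> borel_measurable (lborel \<Otimes>\<^sub>M lborel)"
    by measurable
  show "sets (distr (lborel \<Otimes>\<^sub>M lborel) borel (\<lambda>p. vector [fst p, snd p] :: real^2)) = sets borel" by simp
  fix l u :: "real^2" assume le: "\<And>b. b \<in> Basis \<Longrightarrow> l \<bullet> b \<le> u \<bullet> b"
  have le': "l $ i \<le> u $ i" for i using le[of "axis i 1"] by (simp add: inner_axis)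
  have "(\<lambda>p. vector [fst p, snd p] :: real^2) -` box l u \<inter> space (lborel \<Otimes>\<^sub>M lborel)
     = box (l $ 1) (u $ 1) \<times> box (l $ 2) (u $ 2)"
    by (auto simp: space_pair_measure mem_box_cart forall_2 box_real)
  then have "emeasure (distr (lborel \<Otimes>\<^sub>M lborel) borel (\<lambda>p. vector [fst p, snd p] :: real^2)) (box l u)
     = emeasure (lborel \<Otimes>\<^sub>M lborel) (box (l $ 1) (u $ 1) \<times> box (l $ 2) (u $ 2))"
    by (subst emeasure_distr) (use meas in auto)
  also have "\<dots> = ennreal (u $ 1 - l $ 1) * ennreal (u $ 2 - l $ 2)"
    by (subst lborel.emeasure_pair_measure_Times) (auto simp: box_real le')
  also have "\<dots> = (\<Prod>b\<in>Basis. (u - l) \<bullet> b)"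
  proof -
    have B: "(Basis :: (real^2) set) = {axis 1 1, axis 2 1}" by (auto simp: Basis_vec_def UNIV_2)
    have ne: "axis 1 1 \<noteq> (axis 2 1 :: real^2)" by (simp add: axis_eq_axis)
    show ?thesis unfolding B using ne le' by (simp add: inner_axis ennreal_mult)
  qed
  finally show "emeasure (distr (lborel \<Otimes>\<^sub>M lborel) borel (\<lambda>p. vector [fst p, snd p] :: real^2)) (box l u) = (\<Prod>b\<in>Basis. (u - l) \<bullet> b)" .
qed
lemma nn_integral_real2:
  fixes F :: "real^2 \<Rightarrow> ennreal"
  assumes [measurable]: "F \<in> borel_measurable borel"
  shows "(\<integral>\<^sup>+z. F z \<partial>lborel) = (\<integral>\<^sup>+u. \<integral>\<^sup>+c. F (vector [u, c]) \<partial>lborel \<partial>lborel)"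
proof -
  have "(\<integral>\<^sup>+z. F z \<partial>lborel) = (\<integral>\<^sup>+p. F (vector [fst p, snd p]) \<partial>(lborel \<Otimes>\<^sub>M lborel))"
    by (subst lborel_real2_eq_distr) (simp add: nn_integral_distr)
  also have "\<dots> = (\<integral>\<^sup>+u. \<integral>\<^sup>+c. F (vector [u, c]) \<partial>lborel \<partial>lborel)"
    by (subst lborel.nn_integral_fst[symmetric]) (auto simp: split_def)
  finally show ?thesis .
qed

lemma nn_integral_inverse_1_plus_square:
  "(\<integral>\<^sup>+u. ennreal (1 / (1 + u\<^sup>2)) \<partial>lborel) = ennreal pi"
proof -
  let ?w = "\<lambda>u :: real. 1 / (1 + u\<^sup>2)"
  have half: "(\<integral>\<^sup>+u. ennreal (?w u) * indicator {0..} u \<partial>lborel) = ennreal (pi / 2)"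
  proof -
    have d: "DERIV arctan x :> ?w x" for x :: real
      by (auto intro!: derivative_eq_intros simp: power2_eq_square divide_inverse)
    have "(\<integral>\<^sup>+u. ennreal (?w u) * indicator {0..} u \<partial>lborel) = ennreal (pi / 2 - arctan 0)"
      by (rule nn_integral_FTC_atLeast) (auto intro!: d tendsto_arctan_at_top)
    then show ?thesis by simp
  qed
  have half': "(\<integral>\<^sup>+u. ennreal (?w u) * indicator {..0} u \<partial>lborel) = ennreal (pi / 2)"
  proof -
    have "(\<integral>\<^sup>+u. ennreal (?w u) * indicator {..0} u \<partial>lborel)
       = (\<integral>\<^sup>+u. ennreal (?w (- u)) * indicator {..0} (- u) \<partial>lborel)"
      by (subst nn_integral_real_affine[of _ "-1" 0]) auto
    also have "\<dots> = (\<integral>\<^sup>+u. ennreal (?w u) * indicator {0..} u \<partial>lborel)"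
      by (intro nn_integral_cong) (auto simp: indicator_def)
    finally show ?thesis using half by simp
  qed
  have "(\<integral>\<^sup>+u. ennreal (?w u) \<partial>lborel)
     = (\<integral>\<^sup>+u. ennreal (?w u) * indicator {0..} u + ennreal (?w u) * indicator {..0} u \<partial>lborel)"
    by (intro nn_integral_cong_AE, use AE_lborel_singleton[of "0::real"] in eventually_elim) (auto simp: indicator_def)
  also have "\<dots> = ennreal (pi / 2) + ennreal (pi / 2)"
    by (subst nn_integral_add) (auto simp: half half')
  also have "\<dots> = ennreal pi" by (simp flip: ennreal_plus)
  finally show ?thesis .
qed

section \<open>Functions on the disc vanishing on the circle\<close>

text \<open>The gradient \<open>g\<close> and the Hessian \<open>H\<close> are parameters tied to
  \<open>f\<close> by derivative conditions, so that everything proved here applies to \<open>-f\<close> with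
  \<open>-g\<close> and \<open>-H\<close>. Row \<open>i\<close> of \<open>H\<close> contains the derivatives
  in direction \<open>i\<close>, so the derivative of \<open>g\<close> in direction \<open>h\<close> is a row
  vector times \<open>H\<close>.\<close>
locale disc_function =
  fixes f :: "real^2 \<Rightarrow> real" and g :: "real^2 \<Rightarrow> real^2" and H :: "real^2 \<Rightarrow> real^2^2"
  assumes f_deriv: "\<And>x. norm x < 1 \<Longrightarrow> (f has_derivative (\<lambda>h. g x \<bullet> h)) (at x)"
    and g_deriv: "\<And>x. norm x < 1 \<Longrightarrow> (g has_derivative (\<lambda>h. h v* H x)) (at x)"
    and H_cont: "continuous_on (ball 0 1) H"
    and f_cont: "continuous_on (cball 0 1) f"
    and f_boundary: "\<And>x. norm x = 1 \<Longrightarrow> f x = 0"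
begin

abbreviation regular :: "(real^2) set" where "regular \<equiv> {x. norm x < 1 \<and> g x \<noteq> 0}"

lemma g_cont: "continuous_on (ball 0 1) g"
proof (rule continuous_at_imp_continuous_on, rule ballI)
  fix x :: "real^2" assume "x \<in> ball 0 1"
  then show "isCont g x" by (intro has_derivative_continuous[OF g_deriv]) simp
qed

lemma f_cont_ball: "continuous_on (ball 0 1) f"
  using continuous_on_subset[OF f_cont ball_subset_cball] .

lemma f_along_line:
  assumes "norm (x + s *\<^sub>R e) < 1"
  shows "((\<lambda>s. f (x + s *\<^sub>R e)) has_real_derivative g (x + s *\<^sub>R e) \<bullet> e) (at s)"
proof -
  have 1: "((\<lambda>s. x + s *\<^sub>R e) has_derivative (\<lambda>h. h *\<^sub>R e)) (at s)"
    by (auto intro!: derivative_eq_intros)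
  have "((\<lambda>s. f (x + s *\<^sub>R e)) has_derivative (\<lambda>h. g (x + s *\<^sub>R e) \<bullet> (h *\<^sub>R e))) (at s)"
    by (rule has_derivative_compose[OF 1 f_deriv[OF assms]])
  then show ?thesis by (simp add: has_field_derivative_def mult_commute_abs)
qed

lemma g_along_line:
  assumes "norm (x + s *\<^sub>R e) < 1"
  shows "((\<lambda>s. g (x + s *\<^sub>R e) \<bullet> w) has_real_derivative (e v* H (x + s *\<^sub>R e)) \<bullet> w) (at s)"
proof -
  have 1: "((\<lambda>s. x + s *\<^sub>R e) has_derivative (\<lambda>h. h *\<^sub>R e)) (at s)"
    by (auto intro!: derivative_eq_intros)
  have "((\<lambda>s. g (x + s *\<^sub>R e)) has_derivative (\<lambda>h. (h *\<^sub>R e) v* H (x + s *\<^sub>R e))) (at s)"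
    by (rule has_derivative_compose[OF 1 g_deriv[OF assms]])
  then have "((\<lambda>s. g (x + s *\<^sub>R e) \<bullet> w) has_derivative (\<lambda>h. ((h *\<^sub>R e) v* H (x + s *\<^sub>R e)) \<bullet> w)) (at s)"
    by (rule has_derivative_inner_left)
  moreover have "((h *\<^sub>R e) v* H (x + s *\<^sub>R e)) \<bullet> w = ((e v* H (x + s *\<^sub>R e)) \<bullet> w) * h" for h
    by (simp add: real2_simps algebra_simps)
  ultimately show ?thesis by (simp add: has_field_derivative_def)
qed

lemma f_cont_along:
  assumes "\<And>s. s \<in> S \<Longrightarrow> norm (x + s *\<^sub>R e) \<le> 1"
  shows "continuous_on S (\<lambda>s. f (x + s *\<^sub>R e))"
  by (rule continuous_on_compose2[OF f_cont]) (use assms in \<open>auto intro!: continuous_intros\<close>)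

lemma f_const_along:
  assumes "0 \<le> a" "\<And>s. 0 \<le> s \<Longrightarrow> s < a \<Longrightarrow> norm (x + s *\<^sub>R e) < 1" "norm (x + a *\<^sub>R e) \<le> 1"
    "\<And>s. 0 \<le> s \<Longrightarrow> s < a \<Longrightarrow> g (x + s *\<^sub>R e) \<bullet> e = 0"
  shows "f (x + a *\<^sub>R e) = f x"
proof (cases "a = 0")
  case False
  have "continuous_on {0..a} (\<lambda>s. f (x + s *\<^sub>R e))"
    using assms by (intro f_cont_along) (metis atLeastAtMost_iff less_eq_real_def)
  moreover have "((\<lambda>s. f (x + s *\<^sub>R e)) has_real_derivative 0) (at s)" if "0 < s" "s < a" for s
    using f_along_line[of x s e] assms(2,4)[of s] that by simp
  ultimately have "f (x + a *\<^sub>R e) = f (x + 0 *\<^sub>R e)"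
    using False assms(1) by (intro DERIV_isconst_end[of 0 a "\<lambda>s. f (x + s *\<^sub>R e)"]) auto
  then show ?thesis by simp
qed simp

subsection \<open>Points of first contact\<close>

text \<open>A line orthogonal to the gradient that comes from the downhill side meets no value greater than
  \<open>f x\<close> before it reaches \<open>x\<close>. The strict inequality makes the defining condition
  closed among regular points.\<close>
definition contact :: "(real^2) set" where
  "contact = {x. norm x < 1 \<and> g x \<noteq> 0 \<and> (\<forall>y. norm y < 1 \<longrightarrow> (y - x) \<bullet> g x < 0 \<longrightarrow> f y \<le> f x)}"

text \<open>Maximise the inner product with \<open>\<theta>\<close> over the compact set
  \<open>{f \<ge> c}\<close>, which stays inside the open disc because \<open>c > 0\<close>. At the maximiser
  no direction on the far side of the line can increase \<open>f\<close>.\<close>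
lemma support_point:
  assumes p: "norm p < 1" and c: "0 < c" "c < f p" and "\<theta> \<noteq> 0"
  obtains x a where "norm x < 1" "f x = c" "0 \<le> a" "g x = - a *\<^sub>R \<theta>"
    "\<And>y. norm y < 1 \<Longrightarrow> 0 \<le> (y - x) \<bullet> \<theta> \<Longrightarrow> f y \<le> c"
proof -
  let ?K = "{x \<in> cball 0 1. c \<le> f x}"
  have "closed (cball 0 1 \<inter> f -` {c..})"
    by (rule continuous_closed_preimage[OF f_cont]) auto
  then have "compact (cball 0 1 \<inter> f -` {c..})"
    by (simp add: compact_eq_bounded_closed bounded_Int)
  moreover have "cball 0 1 \<inter> f -` {c..} = ?K" by auto
  ultimately have "compact ?K" by simp
  moreover have "p \<in> ?K" using p c by auto
  moreover have "continuous_on ?K (\<lambda>x. x \<bullet> \<theta>)" by (intro continuous_intros)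
  ultimately obtain x where x: "x \<in> ?K" and sup: "\<And>y. y \<in> ?K \<Longrightarrow> y \<bullet> \<theta> \<le> x \<bullet> \<theta>"
    using continuous_attains_sup[of ?K "\<lambda>x. x \<bullet> \<theta>"] by blast
  have nx: "norm x < 1" using x c f_boundary[of x] by force
  have beyond: "f y < c" if "norm y < 1" "0 < (y - x) \<bullet> \<theta>" for y
    using sup[of y] that by (force simp: inner_diff_left)
  have le: "f y \<le> c" if y: "norm y < 1" "0 \<le> (y - x) \<bullet> \<theta>" for y
  proof -
    have "((\<lambda>s. f (y + s *\<^sub>R \<theta>)) \<longlongrightarrow> f (y + 0 *\<^sub>R \<theta>)) (at_right 0)"
      using DERIV_isCont[OF f_along_line[of y 0 \<theta>]] y(1) by (simp add: isCont_def filterlim_at_split)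
    moreover have "\<forall>\<^sub>F s in at_right 0. f (y + s *\<^sub>R \<theta>) \<le> c"
    proof -
      have "((\<lambda>s. norm (y + s *\<^sub>R \<theta>)) \<longlongrightarrow> norm (y + 0 *\<^sub>R \<theta>)) (at_right 0)"
        by (intro tendsto_intros)
      then have "\<forall>\<^sub>F s in at_right 0. norm (y + s *\<^sub>R \<theta>) < 1"
        using y(1) by (intro order_tendstoD(2)) auto
      moreover have "\<forall>\<^sub>F s :: real in at_right 0. 0 < s" by (simp add: eventually_at_right_less)
      ultimately show ?thesis
      proof eventually_elim
        case (elim s)
        have "0 < s * (\<theta> \<bullet> \<theta>)" using elim \<open>\<theta> \<noteq> 0\<close> by simp
        then have "0 < (y + s *\<^sub>R \<theta> - x) \<bullet> \<theta>" using y(2) by (simp add: inner_simps)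
        then show ?case using beyond[OF elim(1)] by simp
      qed
    qed
    ultimately show ?thesis by (intro tendsto_upperbound[of _ "f y"]) auto
  qed
  have fx: "f x = c" using x le[OF nx] by simp
  have grad: "g x \<bullet> e \<le> 0" if e: "0 \<le> e \<bullet> \<theta>" for e
  proof (rule ccontr)
    assume "\<not> ?thesis"
    then have "0 < g (x + 0 *\<^sub>R e) \<bullet> e" by simp
    then obtain d where d: "d > 0" "\<And>h. 0 < h \<Longrightarrow> h < d \<Longrightarrow> f (x + 0 *\<^sub>R e) < f (x + (0 + h) *\<^sub>R e)"
      using DERIV_pos_inc_right[OF f_along_line[of x 0 e]] nx by auto
    have "((\<lambda>s. norm (x + s *\<^sub>R e)) \<longlongrightarrow> norm (x + 0 *\<^sub>R e)) (at_right 0)" by (intro tendsto_intros)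
    then have "\<forall>\<^sub>F s in at_right 0. norm (x + s *\<^sub>R e) < 1"
      using nx by (intro order_tendstoD(2)) auto
    moreover have "\<forall>\<^sub>F s in at_right 0. s < d" "\<forall>\<^sub>F s :: real in at_right 0. 0 < s"
      using d(1) by (auto intro: eventually_at_right_less simp: eventually_at_right_field)
    ultimately have "\<forall>\<^sub>F s :: real in at_right 0. False"
    proof eventually_elim
      case (elim s)
      then have "f x < f (x + s *\<^sub>R e)" using d(2)[of s] by simp
      moreover have "f (x + s *\<^sub>R e) \<le> c" using elim e by (intro le) auto
      ultimately show False using fx by simp
    qed
    then show False by simp
  qed
  define a where "a = - (g x \<bullet> \<theta>) / (\<theta> \<bullet> \<theta>)"
  have "0 < \<theta> \<bullet> \<theta>" using \<open>\<theta> \<noteq> 0\<close> by simp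
  have "g x \<bullet> perp \<theta> = 0" using grad[of "perp \<theta>"] grad[of "- perp \<theta>"] by simp
  then have "(\<theta> \<bullet> \<theta>) *\<^sub>R g x = (\<theta> \<bullet> \<theta>) *\<^sub>R (- a *\<^sub>R \<theta>)"
    using perp_decomp[of \<theta> "g x"] \<open>0 < \<theta> \<bullet> \<theta>\<close> by (simp add: a_def)
  then have "g x = - a *\<^sub>R \<theta>" using \<open>0 < \<theta> \<bullet> \<theta>\<close> by (simp only: scaleR_cancel_left) auto
  moreover have "0 \<le> a" unfolding a_def using grad[of \<theta>] \<open>0 < \<theta> \<bullet> \<theta>\<close> by (simp add: divide_nonpos_pos)
  ultimately show ?thesis using that nx fx le by blast
qed

text \<open>Taylor's formula at a critical point. The constants are uniform because \<open>{f \<ge> c}\<close>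
  is a compact subset of the open disc, around which the second derivatives are bounded.\<close>
lemma quadratic_lower_bound_at_critical:
  assumes "0 < c"
  shows "\<exists>\<eta>>0. \<exists>K>0. \<forall>x e d. norm x < 1 \<longrightarrow> c \<le> f x \<longrightarrow> g x = 0 \<longrightarrow> norm e = 1 \<longrightarrow> 0 \<le> d \<longrightarrow> d < \<eta> \<longrightarrow>
     norm (x + d *\<^sub>R e) < 1 \<and> f x - K * d\<^sup>2 \<le> f (x + d *\<^sub>R e)"
proof -
  let ?K = "cball 0 1 \<inter> f -` {c..}"
  have "closed ?K"
    by (rule continuous_closed_preimage[OF f_cont]) auto
  then have "compact ?K"
    by (simp add: compact_eq_bounded_closed bounded_Int)
  have "\<exists>r. 0 \<le> r \<and> r < 1 \<and> (\<forall>x\<in>?K. norm x \<le> r)"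
  proof (cases "?K = {}")
    case False
    then obtain z where z: "z \<in> ?K" "\<And>x. x \<in> ?K \<Longrightarrow> norm x \<le> norm z"
      using continuous_attains_sup[OF \<open>compact ?K\<close> False continuous_on_norm_id] by blast
    moreover have "norm z < 1" using z(1) f_boundary[of z] \<open>0 < c\<close> by force
    ultimately show ?thesis by (intro exI[of _ "norm z"]) auto
  qed (auto intro: exI[of _ 0])
  then obtain r where r: "0 \<le> r" "r < 1" "\<And>x. x \<in> ?K \<Longrightarrow> norm x \<le> r" by blast
  define \<eta> where "\<eta> = (1 - r) / 2"
  have \<eta>: "0 < \<eta>" "r + \<eta> < 1" using r unfolding \<eta>_def by (auto simp: field_simps)
  have "compact (H ` cball 0 (r + \<eta>))"
    using \<eta> by (intro compact_continuous_image continuous_on_subset[OF H_cont]) auto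
  then obtain B where B: "0 < B" "\<And>x. norm x \<le> r + \<eta> \<Longrightarrow> norm (H x) \<le> B"
    by (auto dest!: compact_imp_bounded simp: bounded_pos)
  \<comment> \<open>Four matrix entries, each bounded by \<open>B\<close>.\<close>
  define K where "K = 4 * B"
  have low: "- K \<le> (e v* H x) \<bullet> e" if "norm x \<le> r + \<eta>" "norm e = 1" for x e
  proof -
    have entry: "\<bar>H x $ i $ j\<bar> \<le> B" for i j
      using component_le_norm_cart[of "H x $ i" j] Finite_Cartesian_Product.norm_nth_le[of "H x" i] B(2)[OF that(1)] by simp
    have comp: "\<bar>e $ i\<bar> \<le> 1" for i
      using component_le_norm_cart[of e i] that(2) by simp
    have prod_le: "\<bar>e $ i * H x $ i $ j * e $ j\<bar> \<le> B" for i j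
      using mult_mono[OF mult_mono[OF comp[of i] entry[of i j]] comp[of j]] B(1)
      by (simp add: abs_mult)
    have "(e v* H x) \<bullet> e = e $ 1 * H x $ 1 $ 1 * e $ 1 + e $ 2 * H x $ 2 $ 1 * e $ 1
      + (e $ 1 * H x $ 1 $ 2 * e $ 2 + e $ 2 * H x $ 2 $ 2 * e $ 2)"
      by (simp add: real2_simps algebra_simps)
    then show ?thesis
      using prod_le[of 1 1] prod_le[of 1 2] prod_le[of 2 1] prod_le[of 2 2] unfolding K_def by linarith
  qed
  have "norm (x + d *\<^sub>R e) < 1 \<and> f x - K * d\<^sup>2 \<le> f (x + d *\<^sub>R e)"
    if x: "norm x < 1" "c \<le> f x" "g x = 0" and e: "norm e = 1" and d: "0 \<le> d" "d < \<eta>" for x e d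
  proof -
    have nx: "norm (x + s *\<^sub>R e) \<le> r + \<eta>" if "0 \<le> s" "s \<le> d" for s
    proof -
      have "norm x \<le> r" using r(3)[of x] x by simp
      then show ?thesis using norm_triangle_ineq[of x "s *\<^sub>R e"] that d e by simp
    qed
    have nx1: "norm (x + s *\<^sub>R e) < 1" if "0 \<le> s" "s \<le> d" for s
      using nx[OF that] \<eta> by simp
    have slope: "- K * s \<le> g (x + s *\<^sub>R e) \<bullet> e" if s: "0 < s" "s \<le> d" for s
    proof -
      have "\<exists>z>0. z < s \<and> g (x + s *\<^sub>R e) \<bullet> e - g (x + 0 *\<^sub>R e) \<bullet> e
          = (s - 0) * ((e v* H (x + z *\<^sub>R e)) \<bullet> e)"
        by (rule MVT2[OF s(1)]) (use s(2) in \<open>auto intro!: g_along_line nx1\<close>)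
      then obtain z where z: "z > 0" "z < s" and eq: "g (x + s *\<^sub>R e) \<bullet> e - g (x + 0 *\<^sub>R e) \<bullet> e
          = (s - 0) * ((e v* H (x + z *\<^sub>R e)) \<bullet> e)" by blast
      have "s * (- K) \<le> s * ((e v* H (x + z *\<^sub>R e)) \<bullet> e)"
        using low[OF nx e, of z] z s by (intro mult_left_mono) auto
      then show ?thesis using eq x(3) by (simp add: mult.commute)
    qed
    show ?thesis
    proof (cases "d = 0")
      case False
      then have "0 < d" using d by simp
      have "\<exists>z>0. z < d \<and> f (x + d *\<^sub>R e) - f (x + 0 *\<^sub>R e) = (d - 0) * (g (x + z *\<^sub>R e) \<bullet> e)"
        by (rule MVT2[OF \<open>0 < d\<close>]) (auto intro!: f_along_line nx1)
      then obtain z where z: "z > 0" "z < d" and eq: "f (x + d *\<^sub>R e) - f (x + 0 *\<^sub>R e)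
          = (d - 0) * (g (x + z *\<^sub>R e) \<bullet> e)" by blast
      have "K * z \<le> K * d" using z B unfolding K_def by simp
      then have "- K * d \<le> g (x + z *\<^sub>R e) \<bullet> e" using slope[of z] z by simp
      then have "d * (- K * d) \<le> d * (g (x + z *\<^sub>R e) \<bullet> e)" using \<open>0 < d\<close> by (intro mult_left_mono) auto
      then show ?thesis using eq nx1[of d] d by (simp add: power2_eq_square algebra_simps)
    qed (use x in simp)
  qed
  moreover have "0 < K" using B by (simp add: K_def)
  ultimately show ?thesis using \<eta>(1) by blast
qed

text \<open>The levels at which the line orthogonal to \<open>\<theta>\<close> may first touch the superlevel
  set at a critical point.\<close>
definition critical_support_levels :: "real^2 \<Rightarrow> real set" where
  "critical_support_levels \<theta> = {c. 0 < c \<and> (\<exists>x. norm x < 1 \<and> f x = c \<and> g x = 0 \<and>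
     (\<forall>y. norm y < 1 \<longrightarrow> 0 \<le> (y - x) \<bullet> \<theta> \<longrightarrow> f y \<le> c))}"

text \<open>Let \<open>c < c'\<close> be two such levels, touched at \<open>x\<close> and \<open>x'\<close>
  with offsets differing by \<open>d\<close>. Moving from \<open>x'\<close> by \<open>d\<close> reaches the
  line through \<open>x\<close>, where \<open>f \<le> c\<close>, while \<open>f\<close> has dropped by at most
  \<open>K d\<^sup>2\<close> from its critical value \<open>c'\<close>. So the levels depend quadratically on
  the offsets.\<close>
lemma negligible_critical_support_levels:
  assumes "\<theta> \<noteq> 0"
  shows "negligible (critical_support_levels \<theta>)"
proof -
  have "negligible (critical_support_levels \<theta> \<inter> {\<delta>..})" if "0 < \<delta>" for \<delta>
  proof -
    define e where "e = \<theta> /\<^sub>R norm \<theta>"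
    have e: "norm e = 1" "\<theta> = norm \<theta> *\<^sub>R e" using \<open>\<theta> \<noteq> 0\<close> by (auto simp: e_def)
    have ee: "e \<bullet> e = 1" using e by (simp add: dot_square_norm)
    have sgn: "0 \<le> v \<bullet> \<theta> \<longleftrightarrow> 0 \<le> v \<bullet> e" for v
      using \<open>\<theta> \<noteq> 0\<close> by (subst e(2)) (simp add: zero_le_mult_iff)
    have "\<forall>c\<in>critical_support_levels \<theta>. \<exists>x. norm x < 1 \<and> f x = c \<and> g x = 0 \<and>
     (\<forall>y. norm y < 1 \<longrightarrow> 0 \<le> (y - x) \<bullet> e \<longrightarrow> f y \<le> c)"
      unfolding critical_support_levels_def sgn by blast
    then obtain X where X: "\<And>c. c \<in> critical_support_levels \<theta> \<Longrightarrow> norm (X c) < 1 \<and> f (X c) = c \<and> g (X c) = 0 \<and>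
     (\<forall>y. norm y < 1 \<longrightarrow> 0 \<le> (y - X c) \<bullet> e \<longrightarrow> f y \<le> c)"
      unfolding bchoice_iff by blast
    obtain \<eta> K where \<eta>K: "0 < \<eta>" "0 < K"
      and quad: "\<And>x d. \<lbrakk>norm x < 1; \<delta> \<le> f x; g x = 0; 0 \<le> d; d < \<eta>\<rbrakk>
        \<Longrightarrow> norm (x + d *\<^sub>R e) < 1 \<and> f x - K * d\<^sup>2 \<le> f (x + d *\<^sub>R e)"
      using quadratic_lower_bound_at_critical[OF \<open>0 < \<delta>\<close>] e(1) by blast
    have ordered: "\<bar>c - c'\<bar> \<le> K * (X c \<bullet> e - X c' \<bullet> e)\<^sup>2"
      if c: "c \<in> critical_support_levels \<theta>" "c' \<in> critical_support_levels \<theta>" "\<delta> \<le> c'"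
        and "c < c'" "\<bar>X c \<bullet> e - X c' \<bullet> e\<bar> < \<eta>" for c c'
    proof -
      note Xc = X[OF c(1)] and Xc' = X[OF c(2)]
      define d where "d = X c \<bullet> e - X c' \<bullet> e"
      have "0 < d"
      proof (rule ccontr)
        assume "\<not> ?thesis"
        then have "0 \<le> (X c' - X c) \<bullet> e" by (simp add: d_def inner_diff_left)
        then have "f (X c') \<le> c" using Xc Xc' by blast
        then show False using Xc' \<open>c < c'\<close> by simp
      qed
      then have near: "norm (X c' + d *\<^sub>R e) < 1" "f (X c') - K * d\<^sup>2 \<le> f (X c' + d *\<^sub>R e)"
        using quad[of "X c'" d] Xc' c(3) that(5) \<open>0 < d\<close> unfolding d_def by (metis abs_of_pos less_imp_le)+
      have "(X c' + d *\<^sub>R e - X c) \<bullet> e = 0" by (simp add: d_def inner_simps ee)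
      then have "f (X c' + d *\<^sub>R e) \<le> c" using Xc near(1) by simp
      then show ?thesis using near(2) Xc' \<open>c < c'\<close> unfolding d_def by simp
    qed
    show ?thesis
    proof (rule negligible_quadratic_index[of _ "\<lambda>c. X c \<bullet> e" \<eta> K])
      fix c assume "c \<in> critical_support_levels \<theta> \<inter> {\<delta>..}"
      then have "norm (X c) < 1" using X by blast
      then show "\<bar>X c \<bullet> e\<bar> \<le> 1" using Cauchy_Schwarz_ineq2[of "X c" e] e(1) by simp
    next
      fix c c' assume *: "c \<in> critical_support_levels \<theta> \<inter> {\<delta>..}" "c' \<in> critical_support_levels \<theta> \<inter> {\<delta>..}"
        "\<bar>X c \<bullet> e - X c' \<bullet> e\<bar> < \<eta>"
      consider "c < c'" | "c = c'" | "c' < c" by linarith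
      then show "\<bar>c - c'\<bar> \<le> K * (X c \<bullet> e - X c' \<bullet> e)\<^sup>2"
      proof cases
        case 1 then show ?thesis using ordered[of c c'] * by auto
      next
        case 3 then show ?thesis using ordered[of c' c] * by (simp add: abs_minus_commute power2_commute)
      qed simp
    qed (use \<eta>K in auto)
  qed
  then have "negligible (\<Union>n::nat. critical_support_levels \<theta> \<inter> {inverse (real (Suc n))..})"
    by (intro negligible_countable_Union) auto
  moreover have "(\<Union>n::nat. critical_support_levels \<theta> \<inter> {inverse (real (Suc n))..}) = critical_support_levels \<theta>"
  proof (intro equalityI subsetI)
    fix c assume c: "c \<in> critical_support_levels \<theta>"
    then obtain n where "inverse (real (Suc n)) < c"
      using reals_Archimedean[of c] by (auto simp: critical_support_levels_def)
    then show "c \<in> (\<Union>n::nat. critical_support_levels \<theta> \<inter> {inverse (real (Suc n))..})"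
      using c by (intro UN_I[of n]) auto
  qed blast
  ultimately show ?thesis by simp
qed

section \<open>The integral of the tangential second derivative\<close>

text \<open>The second derivative of \<open>f\<close> along the unit tangent of its level line.\<close>
definition tangential_Hessian :: "real^2 \<Rightarrow> real" where
  "tangential_Hessian x = perp (g x) \<bullet> (H x *v perp (g x)) / (g x \<bullet> g x)"

lemma noncontact_open: "open (regular - contact)"
proof -
  have "regular - contact
     = (\<Union>y\<in>ball 0 1. (ball 0 1 \<inter> (\<lambda>x. (y - x) \<bullet> g x) -` {..<0}) \<inter> (ball 0 1 \<inter> (\<lambda>x. f y - f x) -` {0<..}))"
    by (auto simp: contact_def not_le)
  also have "open \<dots>"
    by (intro open_UN ballI open_Int continuous_open_preimage continuous_intros g_cont f_cont_ball) auto
  finally show ?thesis .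
qed

text \<open>Gradients with first coordinate of a fixed sign are described by their slope; the sign
  \<open>\<sigma>\<close> selects one of the two half-circles of directions.\<close>
definition contact_half :: "real \<Rightarrow> (real^2) set" where
  "contact_half \<sigma> = {x \<in> contact. \<sigma> * g x $ 1 < 0}"

text \<open>Images of \<open>\<sigma>\<close>-compact sets under continuous maps are Borel, which makes the
  area of the image under \<open>slope_level\<close> below meaningful.\<close>
lemma contact_half_sigma_compact:
  "\<exists>C :: nat \<Rightarrow> (real^2) set. (\<forall>n. compact (C n)) \<and> contact_half \<sigma> = (\<Union>n. C n)"
proof -
  let ?U = "ball 0 1 \<inter> (\<lambda>x. \<sigma> * g x $ 1) -` {..<0}"
  have "open ?U" by (intro continuous_open_preimage continuous_intros g_cont) auto
  obtain C :: "nat \<Rightarrow> (real^2) set" where C: "\<And>n. compact (C n)" "\<Union>(range C) = ?U"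
    by (rule open_Union_compact_subsets[OF \<open>open ?U\<close>], rule that)
  let ?N = "regular - contact"
  have "contact_half \<sigma> = ?U - ?N" unfolding contact_half_def contact_def by auto
  then have "contact_half \<sigma> = (\<Union>n. C n - ?N)" using C(2) by blast
  moreover have "compact (C n - ?N)" for n using compact_diff[OF C(1) noncontact_open] .
  ultimately show ?thesis by (intro exI[of _ "\<lambda>n. C n - ?N"]) blast
qed

lemma contact_half_borel: "contact_half \<sigma> \<in> sets borel"
proof -
  obtain C :: "nat \<Rightarrow> (real^2) set" where C: "\<And>n. compact (C n)" "contact_half \<sigma> = (\<Union>n. C n)"
    using contact_half_sigma_compact by blast
  have "C n \<in> sets borel" for n using C(1) by (rule borel_compact)
  then show ?thesis unfolding C(2) by (intro sets.countable_UN) auto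
qed

text \<open>The gradient direction, parametrised by its slope, together with the level. The slope
  \<open>u\<close> carries the weight \<open>1/(1+u\<^sup>2)\<close> of the angular measure.\<close>
definition slope_level :: "real^2 \<Rightarrow> real^2" where
  "slope_level x = vector [g x $ 2 / g x $ 1, f x]"

lemma slope_level_deriv:
  assumes "norm x < 1" "g x $ 1 \<noteq> 0"
  shows "(slope_level has_derivative
    (\<lambda>h. vector [(g x $ 1 * (h v* H x) $ 2 - g x $ 2 * (h v* H x) $ 1) / (g x $ 1)\<^sup>2, g x \<bullet> h])) (at x)"
proof -
  have comp: "((\<lambda>x. g x $ i) has_derivative (\<lambda>h. (h v* H x) $ i)) (at x)" for i
    using has_derivative_inner_left[OF g_deriv[OF assms(1)], of "axis i 1"] by (simp add: inner_axis)
  have q: "((\<lambda>x. g x $ 2 / g x $ 1) has_derivative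
      (\<lambda>h. (g x $ 1 * (h v* H x) $ 2 - g x $ 2 * (h v* H x) $ 1) / (g x $ 1)\<^sup>2)) (at x)"
    using has_derivative_divide'[OF comp[of 2] comp[of 1] assms(2)]
    by (simp add: power2_eq_square mult.commute)
  show ?thesis
  proof (subst has_derivative_componentwise_within, rule ballI)
    fix b :: "real^2" assume "b \<in> Basis"
    then consider "b = axis 1 1" | "b = axis 2 1" by (auto simp: Basis_vec_def) (metis exhaust_2)
    then show "((\<lambda>x. slope_level x \<bullet> b) has_derivative (\<lambda>h. (vector
        [(g x $ 1 * (h v* H x) $ 2 - g x $ 2 * (h v* H x) $ 1) / (g x $ 1)\<^sup>2, g x \<bullet> h] :: real^2) \<bullet> b)) (at x)"
      by cases (auto simp: inner_axis slope_level_def intro: q f_deriv[OF assms(1)])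
  qed
qed

text \<open>If \<open>\<alpha>\<close> is the angle of \<open>\<nabla>f\<close>, then
  \<open>d\<alpha>(h) = H(h,t)/|\<nabla>f|\<close> while \<open>df(h) = |\<nabla>f| (n \<bullet> h)\<close>.
  The factors \<open>|\<nabla>f|\<close> cancel in the determinant, whose absolute value is therefore
  \<open>|H(t,t)|\<close>.\<close>
lemma slope_level_jacobian:
  assumes "g x $ 1 \<noteq> 0"
  shows "\<bar>det (matrix (\<lambda>h. vector [(g x $ 1 * (h v* H x) $ 2 - g x $ 2 * (h v* H x) $ 1) / (g x $ 1)\<^sup>2, g x \<bullet> h] :: real^2))\<bar>
     * (1 / (1 + (slope_level x $ 1)\<^sup>2)) = \<bar>tangential_Hessian x\<bar>"
proof -
  define a b where "a = g x $ 1" and "b = g x $ 2"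
  have "a \<noteq> 0" using assms by (simp add: a_def)
  then have pos: "0 < a * a + b * b" by (simp add: sum_squares_gt_zero_iff)
  define q where "q = perp (g x) \<bullet> (H x *v perp (g x))"
  have det: "det (matrix (\<lambda>h. vector [(g x $ 1 * (h v* H x) $ 2 - g x $ 2 * (h v* H x) $ 1) / (g x $ 1)\<^sup>2, g x \<bullet> h] :: real^2))
     = - q / a\<^sup>2"
    using \<open>a \<noteq> 0\<close> unfolding q_def det_2 matrix_def a_def
    by (simp add: real2_simps axis_def field_simps power2_eq_square)
  have w: "1 / (1 + (slope_level x $ 1)\<^sup>2) = a\<^sup>2 / (a * a + b * b)"
    using \<open>a \<noteq> 0\<close> pos unfolding slope_level_def
    by (simp add: a_def[symmetric] b_def[symmetric] field_simps power2_eq_square)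
  have "tangential_Hessian x = q / (a * a + b * b)"
    unfolding tangential_Hessian_def q_def inner_real2[of "g x" "g x"] a_def b_def by simp
  then show ?thesis unfolding det w using \<open>a \<noteq> 0\<close> pos by (simp add: abs_mult)
qed

lemma slope_level_covers:
  assumes p: "norm p < 1" and c: "0 < c" "c < f p" and \<sigma>: "\<bar>\<sigma>\<bar> = 1"
    and reg: "c \<notin> critical_support_levels (\<sigma> *\<^sub>R vector [1, u])"
  shows "vector [u, c] \<in> slope_level ` contact_half \<sigma>"
proof -
  let ?\<theta> = "\<sigma> *\<^sub>R vector [1, u] :: real^2"
  have "?\<theta> \<noteq> 0" using \<sigma> by (auto simp: vec_eq_real2)
  then obtain x a where x: "norm x < 1" "f x = c" "0 \<le> a" "g x = - a *\<^sub>R ?\<theta>"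
    and half: "\<And>y. norm y < 1 \<Longrightarrow> 0 \<le> (y - x) \<bullet> ?\<theta> \<Longrightarrow> f y \<le> c"
    using support_point[OF p c] by metis
  have "a \<noteq> 0" using reg x half c unfolding critical_support_levels_def by force
  then have "0 < a" using x by simp
  have ss: "\<sigma> * \<sigma> = 1" using \<sigma> by (metis abs_mult_self_eq mult_1)
  have "x \<in> contact"
  proof -
    have "f y \<le> f x" if "norm y < 1" "(y - x) \<bullet> g x < 0" for y
    proof -
      have "(y - x) \<bullet> g x = - a * ((y - x) \<bullet> ?\<theta>)" unfolding x(4) by (rule inner_scaleR_right)
      then have "0 < a * ((y - x) \<bullet> ?\<theta>)" using that(2) by linarith
      then have "0 \<le> (y - x) \<bullet> ?\<theta>" using \<open>0 < a\<close> by (simp only: zero_less_mult_pos less_imp_le)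
      then show ?thesis using half[OF that(1)] x(2) by simp
    qed
    moreover have "g x \<noteq> 0" using x(4) \<open>0 < a\<close> \<open>?\<theta> \<noteq> 0\<close> by (simp only: scaleR_eq_0_iff) auto
    ultimately show ?thesis using x(1) unfolding contact_def by blast
  qed
  moreover have "\<sigma> * g x $ 1 = - a * (\<sigma> * \<sigma>)" by (simp add: x(4))
  then have "\<sigma> * g x $ 1 < 0" using ss \<open>0 < a\<close> by simp
  moreover have "slope_level x = vector [u, c]"
    using \<open>0 < a\<close> \<sigma> unfolding slope_level_def x(2,4) by (auto simp: vec_eq_real2)
  ultimately show ?thesis unfolding contact_half_def by force
qed

text \<open>The image of the contact points under \<open>slope_level\<close> fills almost all of
  \<open>UNIV \<times> {0<..<f p}\<close>, whose weighted area is \<open>\<pi> f(p)\<close>. The area of an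
  image, each point counted once, is at most the integral of the Jacobian.\<close>
lemma contact_half_lower_bound:
  assumes p: "norm p < 1" and "0 < f p" and \<sigma>: "\<bar>\<sigma>\<bar> = 1"
    and int: "tangential_Hessian absolutely_integrable_on contact_half \<sigma>"
  shows "pi * f p \<le> integral (contact_half \<sigma>) (\<lambda>x. \<bar>tangential_Hessian x\<bar>)"
proof -
  let ?T = "contact_half \<sigma>" and ?w = "\<lambda>z :: real^2. 1 / (1 + (z $ 1)\<^sup>2)"
  let ?X = "slope_level ` ?T"
  let ?d = "\<lambda>x h. vector [(g x $ 1 * (h v* H x) $ 2 - g x $ 2 * (h v* H x) $ 1) / (g x $ 1)\<^sup>2, g x \<bullet> h] :: real^2"
  have T: "norm x < 1 \<and> g x $ 1 \<noteq> 0" if "x \<in> ?T" for x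
    using that unfolding contact_half_def contact_def by auto
  have der: "(slope_level has_derivative ?d x) (at x within S)" if "x \<in> ?T" for x S
    by (rule has_derivative_at_withinI[OF slope_level_deriv]) (use T[OF that] in simp_all)
  have "(\<lambda>x. \<bar>tangential_Hessian x\<bar>) integrable_on ?T"
    using int by (simp add: absolutely_integrable_on_def)
  moreover have jac: "\<bar>det (matrix (?d x))\<bar> * ?w (slope_level x) = \<bar>tangential_Hessian x\<bar>" if "x \<in> ?T" for x
    using slope_level_jacobian T[OF that] by blast
  ultimately have "(\<lambda>x. \<bar>det (matrix (?d x))\<bar> * ?w (slope_level x)) integrable_on ?T"
    by (subst integrable_cong[OF jac]) 
  then have ub: "?w integrable_on ?X"
    "integral ?X ?w \<le> integral ?T (\<lambda>x. \<bar>det (matrix (?d x))\<bar> * ?w (slope_level x))"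
    using integral_on_image_ubound_nonneg[of ?T ?w slope_level ?d] der by auto
  obtain C :: "nat \<Rightarrow> (real^2) set" where C: "\<And>n. compact (C n)" "?T = (\<Union>n. C n)"
    using contact_half_sigma_compact by blast
  have X_borel [measurable]: "?X \<in> sets borel"
  proof -
    have "compact (slope_level ` C n)" for n
    proof (rule compact_continuous_image[OF _ C(1)])
      show "continuous_on (C n) slope_level"
        by (rule has_derivative_continuous_on, rule der) (use C(2) in auto)
    qed
    then have "slope_level ` C n \<in> sets borel" for n by (rule borel_compact)
    then show ?thesis unfolding C(2) image_UN by (intro sets.countable_UN) auto
  qed
  have w_borel [measurable]: "?w \<in> borel_measurable borel"
    by measurable
  have "ennreal pi * ennreal (f p) = (\<integral>\<^sup>+u. ennreal (1 / (1 + u\<^sup>2)) * ennreal (f p) \<partial>lborel)"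
    by (subst nn_integral_multc) (auto simp: nn_integral_inverse_1_plus_square)
  also have "\<dots> \<le> (\<integral>\<^sup>+u. \<integral>\<^sup>+c. ennreal (?w (vector [u, c])) * indicator ?X (vector [u, c]) \<partial>lborel \<partial>lborel)"
  proof (rule nn_integral_mono)
    fix u :: real
    let ?N = "critical_support_levels (\<sigma> *\<^sub>R vector [1, u])"
    have [measurable]: "(\<lambda>c. vector [u, c] :: real^2) \<in> borel \<rightarrow>\<^sub>M borel"
      using measurable_compose[OF _ measurable_vector_2, of "\<lambda>c. (u, c)" borel] by simp
    have "\<sigma> *\<^sub>R vector [1, u] \<noteq> (0 :: real^2)" using \<sigma> by (auto simp: vec_eq_real2)
    then have null: "?N \<in> null_sets lebesgue"
      using negligible_critical_support_levels negligible_iff_null_sets by blast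
    have "ennreal (f p) = (\<integral>\<^sup>+c. indicator {0<..<f p} c \<partial>lebesgue)"
      using \<open>0 < f p\<close> by simp
    also have "\<dots> \<le> (\<integral>\<^sup>+c. indicator ?X (vector [u, c]) \<partial>lebesgue)"
    proof (rule nn_integral_mono_AE)
      show "AE c in lebesgue. indicator {0<..<f p} c \<le> (indicator ?X (vector [u, c]) :: ennreal)"
        using AE_not_in[OF null]
      proof eventually_elim
        case (elim c)
        then show ?case using slope_level_covers[OF p _ _ \<sigma>, of c u] by (auto simp: indicator_def)
      qed
    qed
    finally have "ennreal (1 / (1 + u\<^sup>2)) * ennreal (f p)
       \<le> ennreal (1 / (1 + u\<^sup>2)) * (\<integral>\<^sup>+c. indicator ?X (vector [u, c]) \<partial>lborel)"
      by (simp add: nn_integral_completion mult_left_mono)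
    also have "\<dots> = (\<integral>\<^sup>+c. ennreal (?w (vector [u, c])) * indicator ?X (vector [u, c]) \<partial>lborel)"
      by (simp add: nn_integral_cmult)
    finally show "ennreal (1 / (1 + u\<^sup>2)) * ennreal (f p)
       \<le> (\<integral>\<^sup>+c. ennreal (?w (vector [u, c])) * indicator ?X (vector [u, c]) \<partial>lborel)" .
  qed
  also have "\<dots> = (\<integral>\<^sup>+z. ennreal (?w z) * indicator ?X z \<partial>lborel)"
    by (rule nn_integral_real2[symmetric]) measurable
  also have "\<dots> = ennreal (integral ?X ?w)"
    by (rule nn_integral_has_integral_lebesgue') (use ub(1) in auto)
  finally have "ennreal (pi * f p) \<le> ennreal (integral ?X ?w)"
    using \<open>0 < f p\<close> by (simp add: ennreal_mult)
  moreover have "0 \<le> integral ?X ?w" using ub(1) by (intro integral_nonneg) auto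
  ultimately have "pi * f p \<le> integral ?X ?w" by simp
  also have "\<dots> \<le> integral ?T (\<lambda>x. \<bar>tangential_Hessian x\<bar>)"
    using ub(2) by (rule order_trans) (simp only: integral_cong[OF jac] order_refl)
  finally show ?thesis .
qed

end

section \<open>Equality in the integral inequality\<close>

text \<open>The reverse inequality is the bound just proved, so equality holds throughout its proof. The point
  \<open>p\<close> will be a maximum point of \<open>f\<close>.\<close>
locale extremal_disc_function = disc_function +
  fixes p :: "real^2"
  assumes p_disc: "norm p < 1" and fp_pos: "0 < f p"
    and norm_integrable: "set_integrable lebesgue (ball 0 1) (\<lambda>x. onorm ((*v) (H x)))"
    and extremal: "(LINT x:ball 0 1|lebesgue. onorm ((*v) (H x))) \<le> 2 * pi * f p"
begin

lemma bilinear_bound: "\<bar>w \<bullet> (H x *v v)\<bar> \<le> onorm ((*v) (H x)) * (norm w * norm v)"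
proof -
  have "\<bar>w \<bullet> (H x *v v)\<bar> \<le> norm w * norm (H x *v v)" by (rule Cauchy_Schwarz_ineq2)
  also have "\<dots> \<le> norm w * (onorm ((*v) (H x)) * norm v)"
    by (intro mult_left_mono onorm) (auto simp: matrix_vector_mul_bounded_linear)
  finally show ?thesis by (simp add: mult_ac)
qed

lemma onorm_nonneg: "0 \<le> onorm ((*v) (H x))"
  by (rule onorm_pos_le) (rule matrix_vector_mul_bounded_linear)

lemma tangential_Hessian_le: "\<bar>tangential_Hessian x\<bar> \<le> onorm ((*v) (H x))"
proof (cases "g x = 0")
  case False
  have "\<bar>perp (g x) \<bullet> (H x *v perp (g x))\<bar> \<le> onorm ((*v) (H x)) * (g x \<bullet> g x)"
    using bilinear_bound[of "perp (g x)" x "perp (g x)"] by (simp add: power2_norm_eq_inner[symmetric] power2_eq_square)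
  then show ?thesis using False unfolding tangential_Hessian_def by (simp add: divide_le_eq)
qed (use onorm_nonneg in \<open>simp add: tangential_Hessian_def\<close>)

lemma perp_g_cont: "continuous_on (ball 0 1) (\<lambda>x. perp (g x))"
  unfolding perp_def by (intro continuous_on_vector_2 continuous_intros g_cont)

lemma H_form_cont:
  assumes "continuous_on (ball 0 1) a" "continuous_on (ball 0 1) b"
  shows "continuous_on (ball 0 1) (\<lambda>x. a x \<bullet> (H x *v b x))"
  unfolding real2_simps by (intro continuous_intros assms H_cont)

lemma tangential_Hessian_cont: "continuous_on regular tangential_Hessian"
  unfolding tangential_Hessian_def
  by (intro continuous_intros continuous_on_subset[OF H_form_cont[OF perp_g_cont perp_g_cont]]
      continuous_on_subset[OF g_cont]) auto

lemma tangential_Hessian_integrable: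
  assumes "S \<in> sets borel" "S \<subseteq> contact"
  shows "tangential_Hessian absolutely_integrable_on S"
proof (rule measurable_bounded_by_integrable_imp_absolutely_integrable)
  show S: "S \<in> sets lebesgue" using assms(1) by simp
  have sub: "S \<subseteq> regular" using assms(2) by (auto simp: contact_def)
  then show "tangential_Hessian \<in> borel_measurable (lebesgue_on S)"
    using S tangential_Hessian_cont by (intro continuous_imp_measurable_on_sets_lebesgue) (auto intro: continuous_on_subset)
  have "set_integrable lebesgue S (\<lambda>x. onorm ((*v) (H x)))"
    by (rule set_integrable_subset[OF norm_integrable S]) (use sub in auto)
  then show "(\<lambda>x. onorm ((*v) (H x))) integrable_on S" by (rule set_lebesgue_integral_eq_integral)
qed (use tangential_Hessian_le in auto)

text \<open>The two half-circles of directions together give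
  \<open>2 \<pi> f(p) \<le> \<integral> |H(t,t)|\<close> over the contact points, so the nonnegative
  difference between \<open>\<parallel>H\<parallel>\<close> and \<open>|H(t,t)|\<close> restricted to them has
  integral zero.\<close>
lemma AE_equality:
  "AE x in lebesgue. norm x < 1 \<longrightarrow> onorm ((*v) (H x)) = 0 \<or>
     x \<in> contact \<and> onorm ((*v) (H x)) = \<bar>tangential_Hessian x\<bar>"
proof -
  let ?N = "\<lambda>x. onorm ((*v) (H x))"
  let ?\<kappa> = "\<lambda>x. \<bar>tangential_Hessian x\<bar>"
  let ?P = "contact_half 1" and ?Q = "contact_half (-1)"
  have sub: "?P \<subseteq> contact" "?Q \<subseteq> contact" by (auto simp: contact_half_def)
  have disj: "?P \<inter> ?Q = {}" by (auto simp: contact_half_def)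
  have ints: "set_integrable lebesgue ?P tangential_Hessian" "set_integrable lebesgue ?Q tangential_Hessian"
    using tangential_Hessian_integrable contact_half_borel sub by auto
  then have int: "set_integrable lebesgue ?P ?\<kappa>" "set_integrable lebesgue ?Q ?\<kappa>"
    by (auto intro: set_integrable_abs)
  have half: "pi * f p \<le> (LINT x:?P|lebesgue. ?\<kappa> x)" "pi * f p \<le> (LINT x:?Q|lebesgue. ?\<kappa> x)"
    using contact_half_lower_bound[OF p_disc fp_pos, of 1] contact_half_lower_bound[OF p_disc fp_pos, of "-1"] ints
    by (simp_all add: set_lebesgue_integral_eq_integral(2)[OF int(1)] set_lebesgue_integral_eq_integral(2)[OF int(2)])
  have PQ: "set_integrable lebesgue (?P \<union> ?Q) ?\<kappa>"
    using int contact_half_borel by (intro set_integrable_Un) auto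
  have "(LINT x:?P \<union> ?Q|lebesgue. ?\<kappa> x) = (LINT x:?P|lebesgue. ?\<kappa> x) + (LINT x:?Q|lebesgue. ?\<kappa> x)"
    by (rule set_integral_Un[OF disj int])
  then have total: "(LINT x:ball 0 1|lebesgue. ?N x) \<le> (LINT x:?P \<union> ?Q|lebesgue. ?\<kappa> x)"
    using half extremal by simp
  define \<psi> where "\<psi> x = indicator (ball 0 1) x * ?N x - indicator (?P \<union> ?Q) x * ?\<kappa> x" for x
  have \<psi>_int: "integrable lebesgue \<psi>" unfolding \<psi>_def
    using norm_integrable PQ by (intro Bochner_Integration.integrable_diff) (simp_all add: set_integrable_def)
  have \<psi>_nonneg: "0 \<le> \<psi> x" for x
    using tangential_Hessian_le[of x] onorm_nonneg[of x] sub
    by (auto simp: \<psi>_def indicator_def contact_def)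
  have "integral\<^sup>L lebesgue \<psi> \<le> 0"
    using total norm_integrable PQ unfolding \<psi>_def
    by (subst Bochner_Integration.integral_diff) (simp_all add: set_integrable_def set_lebesgue_integral_def)
  moreover have "0 \<le> integral\<^sup>L lebesgue \<psi>" using \<psi>_nonneg by (intro Bochner_Integration.integral_nonneg) auto
  ultimately have "integral\<^sup>L lebesgue \<psi> = 0" by simp
  then have "AE x in lebesgue. \<psi> x = 0"
    using integral_nonneg_eq_0_iff_AE[OF \<psi>_int] \<psi>_nonneg by simp
  then show ?thesis
  proof eventually_elim
    case (elim x)
    show ?case
    proof (cases "x \<in> ?P \<union> ?Q")
      case True
      then have "x \<in> contact" using sub by blast
      then show ?thesis using elim True by (auto simp: \<psi>_def contact_def)
    next
      case False
      then show ?thesis using elim by (auto simp: \<psi>_def)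
    qed
  qed
qed

text \<open>A matrix whose norm is attained by the quadratic form at the unit vector \<open>t\<close> maps
  \<open>t\<close> to a multiple of itself, and so does its transpose. To see it, let \<open>q\<close> be the
  value of the form and \<open>s\<close> the off-diagonal entry, and test with the combination having
  coefficients \<open>q\<close> and \<open>s\<close>.\<close>
lemma Hessian_aligned_if_norm_attained:
  assumes "onorm ((*v) (H x)) = 0 \<or> g x \<noteq> 0 \<and> onorm ((*v) (H x)) = \<bar>tangential_Hessian x\<bar>"
  shows "g x \<bullet> (H x *v perp (g x)) = 0" "perp (g x) \<bullet> (H x *v g x) = 0"
    "\<bar>g x \<bullet> (H x *v g x)\<bar> \<le> \<bar>perp (g x) \<bullet> (H x *v perp (g x))\<bar>"
proof -
  define G \<tau> where "G = g x" and "\<tau> = perp (g x)"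
  define q where "q = \<tau> \<bullet> (H x *v \<tau>)"
  have orth: "G \<bullet> \<tau> = 0" "\<tau> \<bullet> G = 0" "\<tau> \<bullet> \<tau> = G \<bullet> G" unfolding G_def \<tau>_def by simp_all
  let ?N = "onorm ((*v) (H x))"
  have Nq: "?N * (G \<bullet> G) = \<bar>q\<bar>"
  proof (cases "?N = 0")
    case True
    then show ?thesis using bilinear_bound[of \<tau> x \<tau>] by (simp add: q_def)
  next
    case False
    then have "g x \<noteq> 0" "?N = \<bar>tangential_Hessian x\<bar>" using assms by auto
    then show ?thesis by (simp add: tangential_Hessian_def q_def \<tau>_def G_def abs_divide)
  qed
  have key: "s = 0" if s: "\<bar>q * q + s * s\<bar> \<le> ?N * (norm (q *\<^sub>R \<tau> + s *\<^sub>R G) * norm \<tau>)" for s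
  proof (rule ccontr)
    assume "s \<noteq> 0"
    then have pos: "0 < q * q + s * s" by (simp add: sum_squares_gt_zero_iff)
    have n1: "(norm (q *\<^sub>R \<tau> + s *\<^sub>R G))\<^sup>2 = (q * q + s * s) * (G \<bullet> G)"
      unfolding power2_norm_eq_inner by (simp add: inner_simps orth algebra_simps)
    have n2: "(norm \<tau>)\<^sup>2 = G \<bullet> G" unfolding power2_norm_eq_inner by (rule orth)
    have "(q * q + s * s)\<^sup>2 \<le> (?N * (norm (q *\<^sub>R \<tau> + s *\<^sub>R G) * norm \<tau>))\<^sup>2"
      using s pos by (intro power_mono) auto
    also have "\<dots> = (?N * (G \<bullet> G))\<^sup>2 * (q * q + s * s)"
      unfolding power_mult_distrib n1 n2 by (simp add: power2_eq_square)
    also have "\<dots> = q * q * (q * q + s * s)" unfolding Nq by (simp add: power2_eq_square)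
    finally have "q * q + s * s \<le> q * q" using pos by (simp add: power2_eq_square)
    then show False using \<open>s \<noteq> 0\<close> by (auto simp: mult_le_0_iff)
  qed
  have "G \<bullet> (H x *v \<tau>) = 0"
    using bilinear_bound[of "q *\<^sub>R \<tau> + (G \<bullet> (H x *v \<tau>)) *\<^sub>R G" x \<tau>]
    by (intro key) (simp add: inner_add_left q_def)
  then show "g x \<bullet> (H x *v perp (g x)) = 0" by (simp add: G_def \<tau>_def)
  have "\<tau> \<bullet> (H x *v G) = 0"
    using bilinear_bound[of \<tau> x "q *\<^sub>R \<tau> + (\<tau> \<bullet> (H x *v G)) *\<^sub>R G"]
    by (intro key) (simp add: matrix_vector_right_distrib matrix_vector_mult_scaleR inner_add_right q_def mult_ac)
  then show "perp (g x) \<bullet> (H x *v g x) = 0" by (simp add: G_def \<tau>_def)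
  have "\<bar>G \<bullet> (H x *v G)\<bar> \<le> ?N * (G \<bullet> G)"
    using bilinear_bound[of G x G] by (simp add: power2_norm_eq_inner[symmetric] power2_eq_square)
  then show "\<bar>g x \<bullet> (H x *v g x)\<bar> \<le> \<bar>perp (g x) \<bullet> (H x *v perp (g x))\<bar>"
    unfolding Nq by (simp add: q_def G_def \<tau>_def)
qed

text \<open>The relations are closed conditions on the continuous \<open>g\<close> and \<open>H\<close>, so
  they pass from almost every point to every point; critical points satisfy them trivially.\<close>
lemma Hessian_aligned:
  assumes x: "norm x < 1"
  shows "g x \<bullet> (H x *v perp (g x)) = 0" "perp (g x) \<bullet> (H x *v g x) = 0"
    "\<bar>g x \<bullet> (H x *v g x)\<bar> \<le> \<bar>perp (g x) \<bullet> (H x *v perp (g x))\<bar>"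
proof -
  have AE: "AE x in lebesgue. x \<in> ball 0 1 \<longrightarrow>
      \<bar>g x \<bullet> (H x *v perp (g x))\<bar> \<le> 0 \<and> \<bar>perp (g x) \<bullet> (H x *v g x)\<bar> \<le> 0 \<and>
      \<bar>g x \<bullet> (H x *v g x)\<bar> - \<bar>perp (g x) \<bullet> (H x *v perp (g x))\<bar> \<le> 0"
    using AE_equality
  proof eventually_elim
    case (elim x)
    then show ?case using Hessian_aligned_if_norm_attained[of x] by (auto simp: contact_def)
  qed
  have "\<bar>g x \<bullet> (H x *v perp (g x))\<bar> \<le> 0"
    by (rule nonpos_if_AE_nonpos[of "ball 0 1" "\<lambda>x. \<bar>g x \<bullet> (H x *v perp (g x))\<bar>"])
      (use AE x in \<open>auto intro!: continuous_on_rabs H_form_cont g_cont perp_g_cont\<close>)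
  then show "g x \<bullet> (H x *v perp (g x)) = 0" by simp
  have "\<bar>perp (g x) \<bullet> (H x *v g x)\<bar> \<le> 0"
    by (rule nonpos_if_AE_nonpos[of "ball 0 1" "\<lambda>x. \<bar>perp (g x) \<bullet> (H x *v g x)\<bar>"])
      (use AE x in \<open>auto intro!: continuous_on_rabs H_form_cont g_cont perp_g_cont\<close>)
  then show "perp (g x) \<bullet> (H x *v g x) = 0" by simp
  have "\<bar>g x \<bullet> (H x *v g x)\<bar> - \<bar>perp (g x) \<bullet> (H x *v perp (g x))\<bar> \<le> 0"
    by (rule nonpos_if_AE_nonpos[of "ball 0 1" "\<lambda>x. \<bar>g x \<bullet> (H x *v g x)\<bar> - \<bar>perp (g x) \<bullet> (H x *v perp (g x))\<bar>"])
      (use AE x in \<open>auto intro!: continuous_on_diff continuous_on_rabs H_form_cont g_cont perp_g_cont\<close>)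
  then show "\<bar>g x \<bullet> (H x *v g x)\<bar> \<le> \<bar>perp (g x) \<bullet> (H x *v perp (g x))\<bar>" by simp
qed

definition normal_Hessian :: "real^2 \<Rightarrow> real" where
  "normal_Hessian x = g x \<bullet> (H x *v g x) / (g x \<bullet> g x)"

lemma gradient_derivative_diagonal:
  assumes "norm x < 1" "g x \<noteq> 0"
  shows "(g x \<bullet> g x) *\<^sub>R (h v* H x) = (tangential_Hessian x * (h \<bullet> perp (g x))) *\<^sub>R perp (g x)
      + (normal_Hessian x * (h \<bullet> g x)) *\<^sub>R g x"
    and "\<bar>normal_Hessian x\<bar> \<le> \<bar>tangential_Hessian x\<bar>"
proof -
  define G \<tau> where "G = g x" and "\<tau> = perp (g x)"
  have \<tau>: "\<tau> = perp G" by (simp add: \<tau>_def G_def)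
  have pos: "0 < G \<bullet> G" using assms by (simp add: G_def)
  note al = Hessian_aligned[OF assms(1), folded \<tau>_def, folded G_def]
  have curv: "tangential_Hessian x * (G \<bullet> G) = \<tau> \<bullet> (H x *v \<tau>)" "normal_Hessian x * (G \<bullet> G) = G \<bullet> (H x *v G)"
    using pos by (simp_all add: tangential_Hessian_def normal_Hessian_def \<tau>_def G_def)
  have "(G \<bullet> G) *\<^sub>R (H x *v \<tau>) = (\<tau> \<bullet> (H x *v \<tau>)) *\<^sub>R \<tau>"
    using perp_decomp[of G "H x *v \<tau>"] al(1) unfolding \<tau>[symmetric] by (simp add: inner_commute)
  also have "\<dots> = (G \<bullet> G) *\<^sub>R (tangential_Hessian x *\<^sub>R \<tau>)" by (simp add: curv(1)[symmetric] mult.commute)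
  finally have 1: "H x *v \<tau> = tangential_Hessian x *\<^sub>R \<tau>" using pos by (simp only: scaleR_cancel_left) auto
  have "(G \<bullet> G) *\<^sub>R (H x *v G) = (G \<bullet> (H x *v G)) *\<^sub>R G"
    using perp_decomp[of G "H x *v G"] al(2) unfolding \<tau>[symmetric] by (simp add: inner_commute)
  also have "\<dots> = (G \<bullet> G) *\<^sub>R (normal_Hessian x *\<^sub>R G)" by (simp add: curv(2)[symmetric] mult.commute)
  finally have 2: "H x *v G = normal_Hessian x *\<^sub>R G" using pos by (simp only: scaleR_cancel_left) auto
  have "(G \<bullet> G) *\<^sub>R (h v* H x) = (tangential_Hessian x * (h \<bullet> \<tau>)) *\<^sub>R \<tau> + (normal_Hessian x * (h \<bullet> G)) *\<^sub>R G"
    using perp_decomp[of G "h v* H x"] unfolding \<tau>[symmetric] dot_lmul_matrix 1 2 by simp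
  then show "(g x \<bullet> g x) *\<^sub>R (h v* H x) = (tangential_Hessian x * (h \<bullet> perp (g x))) *\<^sub>R perp (g x)
      + (normal_Hessian x * (h \<bullet> g x)) *\<^sub>R g x" by (simp add: G_def \<tau>_def)
  have "\<bar>normal_Hessian x\<bar> * (G \<bullet> G) \<le> \<bar>tangential_Hessian x\<bar> * (G \<bullet> G)"
    using al(3) pos unfolding curv[symmetric] by (simp add: abs_mult)
  then show "\<bar>normal_Hessian x\<bar> \<le> \<bar>tangential_Hessian x\<bar>" using pos by simp
qed

lemma Hessian_zero_off_contact:
  assumes "x \<in> regular - contact"
  shows "H x = 0"
proof -
  let ?O = "regular - contact"
  have "\<bar>H x $ i $ j\<bar> \<le> 0" for i j
  proof (rule nonpos_if_AE_nonpos[OF noncontact_open _ _ assms])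
    show "continuous_on ?O (\<lambda>x. \<bar>H x $ i $ j\<bar>)"
      by (intro continuous_intros continuous_on_subset[OF H_cont]) auto
    show "AE x in lebesgue. x \<in> ?O \<longrightarrow> \<bar>H x $ i $ j\<bar> \<le> 0"
      using AE_equality
    proof eventually_elim
      case (elim x)
      then show ?case using matrix_component_le_onorm[of "H x" i j] by auto
    qed
  qed
  then show ?thesis by (simp add: vec_eq_iff)
qed

section \<open>Every regular point is a contact point\<close>

text \<open>Around a regular noncontact point \<open>H = 0\<close>, so \<open>f\<close> is affine. Follow the
  level line through it. If it reached a contact point inside the disc, that point would have the same
  gradient, level and tangent line, so contact would hold at the start as well. Hence it runs into the circle,
  where \<open>f = 0\<close>.\<close>
lemma noncontact_f_zero:
  assumes x: "x \<in> regular - contact"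
  shows "f x = 0"
proof -
  let ?O = "regular - contact"
  define e where "e = perp (g x) /\<^sub>R norm (g x)"
  have e: "norm e = 1" "e \<bullet> g x = 0" "g x \<bullet> e = 0" using x by (auto simp: e_def)
  have nx: "norm x < 1" using x by auto
  define b where "b = exit_time x e"
  note b = exit_time[OF nx e(1), folded b_def]
  have "x + b *\<^sub>R e \<notin> ?O" using b(2) by simp
  moreover have "continuous_on {0..b} (\<lambda>s. x + s *\<^sub>R e)" by (intro continuous_intros)
  ultimately obtain s where s: "0 < s" "s \<le> b" "x + s *\<^sub>R e \<notin> ?O" "\<And>r. 0 \<le> r \<Longrightarrow> r < s \<Longrightarrow> x + r *\<^sub>R e \<in> ?O"
    using first_exit[OF noncontact_open, of b "\<lambda>s. x + s *\<^sub>R e"] b(1) x by auto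
  have inside: "norm (x + r *\<^sub>R e) < 1" if "0 \<le> r" "r < s" for r using s(4)[OF that] by auto
  have ns: "norm (x + s *\<^sub>R e) \<le> 1"
    using b(2) b(3)[of s] s(1,2) by (cases "s = b") auto
  have gconst: "g (x + r *\<^sub>R e) = g x" if r: "0 \<le> r" "r \<le> s" "norm (x + r *\<^sub>R e) < 1" for r
  proof (cases "r = 0")
    case False
    have "g (x + r *\<^sub>R e) \<bullet> w = g (x + 0 *\<^sub>R e) \<bullet> w" for w
    proof (rule DERIV_isconst_end[of 0 r "\<lambda>s. g (x + s *\<^sub>R e) \<bullet> w"])
      show "0 < r" using r False by simp
      have "norm (x + q *\<^sub>R e) < 1" if "0 \<le> q" "q \<le> r" for q
        using inside[of q] r that by (cases "q = r") auto
      then show "continuous_on {0..r} (\<lambda>s. g (x + s *\<^sub>R e) \<bullet> w)"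
        by (intro continuous_at_imp_continuous_on ballI DERIV_isCont[OF g_along_line]) auto
      show "((\<lambda>s. g (x + s *\<^sub>R e) \<bullet> w) has_real_derivative 0) (at q)" if "0 < q" "q < r" for q
        using g_along_line[of x q e w] inside[of q] Hessian_zero_off_contact[OF s(4)[of q]] that r by simp
    qed
    then show ?thesis using vector_eq_rdot by (metis add_0_right scaleR_zero_left)
  qed simp
  have fs: "f (x + s *\<^sub>R e) = f x"
    using s(1) inside ns gconst e by (intro f_const_along) auto
  show ?thesis
  proof (cases "norm (x + s *\<^sub>R e) < 1")
    case False
    then show ?thesis using f_boundary[of "x + s *\<^sub>R e"] ns fs by simp
  next
    case True
    let ?z = "x + s *\<^sub>R e"
    have gz: "g ?z = g x" using gconst[of s] True s by simp
    then have z: "?z \<in> contact" using s(3) True x by auto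
    have "f y \<le> f x" if y: "norm y < 1" "(y - x) \<bullet> g x < 0" for y
    proof -
      have "(y - ?z) \<bullet> g ?z = (y - x) \<bullet> g x" unfolding gz by (simp add: inner_simps e)
      then have "f y \<le> f ?z" using z y unfolding contact_def by auto
      then show ?thesis using fs by simp
    qed
    then have "x \<in> contact" using x unfolding contact_def by blast
    then show ?thesis using x by simp
  qed
qed

text \<open>The noncontact points form an open set on which \<open>f\<close> vanishes, hence also its
  gradient.\<close>
lemma regular_contact:
  assumes "norm x < 1" "g x \<noteq> 0"
  shows "x \<in> contact"
proof (rule ccontr)
  let ?O = "regular - contact"
  assume "x \<notin> contact"
  then have "x \<in> ?O" using assms by simp
  moreover have "f y = 0" if "y \<in> ?O" for y using noncontact_f_zero[OF that] .
  ultimately have "(f has_derivative (\<lambda>h. 0)) (at x)"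
    by (intro has_derivative_transform_within_open[OF has_derivative_const noncontact_open]) auto
  then have "(\<lambda>h. g x \<bullet> h) = (\<lambda>h. 0)" using f_deriv[OF assms(1)] has_derivative_unique by blast
  then have "g x \<bullet> g x = 0" by meson
  then show False using assms by simp
qed

lemma f_le_downhill:
  assumes "norm x < 1" "g x \<noteq> 0" "norm y < 1" "(y - x) \<bullet> g x < 0"
  shows "f y \<le> f x"
  using regular_contact[OF assms(1,2)] assms(3,4) by (simp add: contact_def)

text \<open>The downhill half-plane reaches the circle, where \<open>f = 0\<close>.\<close>
lemma f_nonneg_regular:
  assumes x: "norm x < 1" "g x \<noteq> 0"
  shows "0 \<le> f x"
proof -
  define e where "e = - g x /\<^sub>R norm (g x)"
  have e: "norm e = 1" "e \<bullet> g x < 0" using x by (auto simp: e_def)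
  define b where "b = exit_time x e"
  note b = exit_time[OF x(1) e(1), folded b_def]
  have "f (x + b *\<^sub>R e) \<le> f x"
  proof (rule le_at_right_end[of 0 b "\<lambda>s. f (x + s *\<^sub>R e)"])
    show "continuous_on {0..b} (\<lambda>s. f (x + s *\<^sub>R e))"
      using b by (intro f_cont_along) (metis atLeastAtMost_iff less_eq_real_def)
    show "f (x + s *\<^sub>R e) \<le> f x" if "0 < s" "s < b" for s
      using b(3)[of s] that e x by (intro f_le_downhill) (auto simp: mult_pos_neg)
  qed (rule b)
  then show ?thesis using f_boundary[OF b(2)] by simp
qed

text \<open>Where \<open>f\<close> is negative its gradient vanishes, so along a segment to the circle
  \<open>f\<close> would stay constant and could not reach \<open>0\<close>.\<close>
lemma f_nonneg:
  assumes x: "norm x < 1"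
  shows "0 \<le> f x"
proof (rule ccontr)
  assume neg: "\<not> 0 \<le> f x"
  obtain e :: "real^2" where e: "norm e = 1" using norm_axis_1 by blast
  define b where "b = exit_time x e"
  note b = exit_time[OF x e, folded b_def]
  have cont: "continuous_on {0..b} (\<lambda>s. f (x + s *\<^sub>R e))"
    using b by (intro f_cont_along) (metis atLeastAtMost_iff less_eq_real_def)
  obtain s where s: "0 < s" "s \<le> b" "f (x + s *\<^sub>R e) \<notin> {..<0}"
     "\<And>r. 0 \<le> r \<Longrightarrow> r < s \<Longrightarrow> f (x + r *\<^sub>R e) \<in> {..<0}"
    using first_exit[of "{..<0}", OF _ cont] b(1) f_boundary[OF b(2)] neg by auto
  have inside: "norm (x + r *\<^sub>R e) < 1" if "0 \<le> r" "r < s" for r using b(3)[of r] that s by simp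
  have "f (x + s *\<^sub>R e) = f x"
  proof (rule f_const_along)
    show "norm (x + s *\<^sub>R e) \<le> 1" using b(2) b(3)[of s] s(1,2) by (cases "s = b") auto
    show "g (x + r *\<^sub>R e) \<bullet> e = 0" if "0 \<le> r" "r < s" for r
      using f_nonneg_regular[OF inside[OF that]] s(4)[OF that] by force
  qed (use s inside in auto)
  then show False using s(3) neg by simp
qed

lemma f_pos_regular:
  assumes x: "norm x < 1" "g x \<noteq> 0"
  shows "0 < f x"
proof -
  have "f x \<noteq> 0"
  proof
    assume "f x = 0"
    then have min: "f x \<le> f y" if "y \<in> ball 0 1" for y using f_nonneg that by simp
    have "(\<lambda>h. g x \<bullet> h) = (\<lambda>h. 0)"
      by (rule has_derivative_local_min[of f]) (use f_deriv[OF x(1)] min x(1) in \<open>auto simp: eventually_at_topological intro!: exI[of _ "ball 0 1"]\<close>)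
    then have "g x \<bullet> g x = 0" by meson
    then show False using x by simp
  qed
  then show ?thesis using f_nonneg_regular[OF x] by simp
qed

section \<open>Straight gradient lines\<close>

lemma regular_open: "open regular"
proof -
  have "regular = ball 0 1 \<inter> g -` (- {0})" by auto
  then show ?thesis using continuous_open_preimage[OF g_cont open_ball, of "- {0}"] by (simp add: open_Compl)
qed

text \<open>The component \<open>q\<close> of the gradient perpendicular to the line starts at
  \<open>0\<close>; as \<open>H(n,t) = 0\<close>, its derivative is a bounded multiple of \<open>q\<close>
  itself.\<close>
lemma gradient_direction_constant:
  assumes e: "e = c *\<^sub>R g x" and a: "0 \<le> a"
    and reg: "\<And>s. 0 \<le> s \<Longrightarrow> s \<le> a \<Longrightarrow> x + s *\<^sub>R e \<in> regular"
  shows "\<exists>\<rho>>0. g (x + a *\<^sub>R e) = \<rho> *\<^sub>R g x"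
proof -
  define \<gamma> where "\<gamma> s = x + s *\<^sub>R e" for s
  define q where "q s = g (\<gamma> s) \<bullet> perp (g x)" for s
  define q' where "q' s = (e v* H (\<gamma> s)) \<bullet> perp (g x)" for s
  have \<gamma>: "\<gamma> s \<in> regular" if "0 \<le> s" "s \<le> a" for s using reg[OF that] by (simp add: \<gamma>_def)
  have gx: "0 < g x \<bullet> g x" using reg[of 0] a by simp
  have der: "(q has_real_derivative q' s) (at s)" if "0 \<le> s" "s \<le> a" for s
    using g_along_line[of x s e] \<gamma>[OF that] unfolding q_def q'_def \<gamma>_def by simp
  have cont: "continuous_on {0..a} \<gamma>" unfolding \<gamma>_def by (intro continuous_intros)
  have "compact ((\<lambda>s. tangential_Hessian (\<gamma> s) / norm (g (\<gamma> s))) ` {0..a})"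
    by (intro compact_continuous_image continuous_intros
        continuous_on_compose2[OF tangential_Hessian_cont cont] continuous_on_compose2[OF g_cont cont])
      (use \<gamma> in auto)
  then have "\<exists>B. \<forall>s\<in>{0..a}. \<bar>tangential_Hessian (\<gamma> s) / norm (g (\<gamma> s))\<bar> \<le> B"
    by (auto dest!: compact_imp_bounded simp: bounded_iff)
  then obtain B where "\<forall>s\<in>{0..a}. \<bar>tangential_Hessian (\<gamma> s) / norm (g (\<gamma> s))\<bar> \<le> B" ..
  then have B: "\<bar>tangential_Hessian (\<gamma> s) / norm (g (\<gamma> s))\<bar> \<le> B" if "0 \<le> s" "s \<le> a" for s
    using that by (meson atLeastAtMost_iff)
  define C where "C = \<bar>c\<bar> * (2 * B * norm (g x))"
  have bound: "\<bar>q' s\<bar> \<le> C * \<bar>q s\<bar>" if s: "0 \<le> s" "s \<le> a" for s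
  proof -
    let ?y = "\<gamma> s"
    let ?l = "tangential_Hessian ?y" and ?m = "normal_Hessian ?y"
    have y: "norm ?y < 1" "g ?y \<noteq> 0" using \<gamma>[OF s] by auto
    have pos: "0 < norm (g ?y)" using y by simp
    have sw: "g x \<bullet> perp (g ?y) = - q s" by (simp add: q_def real2_simps)
    have "(g ?y \<bullet> g ?y) * q' s = (?l * (e \<bullet> perp (g ?y))) * (perp (g ?y) \<bullet> perp (g x))
        + (?m * (e \<bullet> g ?y)) * (g ?y \<bullet> perp (g x))"
      unfolding q'_def inner_scaleR_left[symmetric] inner_add_left[symmetric]
        gradient_derivative_diagonal(1)[OF y] ..
    also have "\<dots> = c * (?m - ?l) * (g x \<bullet> g ?y) * q s"
      by (simp add: e sw q_def[symmetric] inner_commute[of "g ?y" "g x"] algebra_simps)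
    finally have "(norm (g ?y))\<^sup>2 * \<bar>q' s\<bar> = \<bar>c\<bar> * \<bar>?m - ?l\<bar> * \<bar>g x \<bullet> g ?y\<bar> * \<bar>q s\<bar>"
      unfolding power2_norm_eq_inner by (metis abs_mult abs_of_nonneg inner_ge_zero)
    also have "\<dots> \<le> \<bar>c\<bar> * (2 * (B * norm (g ?y))) * (norm (g x) * norm (g ?y)) * \<bar>q s\<bar>"
    proof -
      have "\<bar>?l\<bar> \<le> B * norm (g ?y)" using B[OF s] pos by (simp add: abs_divide divide_le_eq)
      then have "\<bar>?m - ?l\<bar> \<le> 2 * (B * norm (g ?y))" using gradient_derivative_diagonal(2)[OF y] by linarith
      moreover have "0 \<le> 2 * (B * norm (g ?y))" using calculation by linarith
      ultimately show ?thesis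
        by (intro mult_right_mono mult_mono mult_left_mono Cauchy_Schwarz_ineq2) auto
    qed
    also have "\<dots> = (norm (g ?y))\<^sup>2 * (C * \<bar>q s\<bar>)" by (simp add: C_def power2_eq_square mult_ac)
    finally show ?thesis using pos by simp
  qed
  have "q 0 = 0" by (simp add: q_def \<gamma>_def)
  have q0: "q s = 0" if s: "0 \<le> s" "s \<le> a" for s
  proof -
    have "(q s)\<^sup>2 \<le> (q 0)\<^sup>2 * exp (2 * C * s)"
      using s der bound by (intro gronwall_squares(1)[of s q q']) auto
    then show ?thesis using \<open>q 0 = 0\<close> by simp
  qed
  have par: "(g x \<bullet> g x) *\<^sub>R g (\<gamma> s) = (g (\<gamma> s) \<bullet> g x) *\<^sub>R g x" if "0 \<le> s" "s \<le> a" for s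
    using perp_decomp[of "g x" "g (\<gamma> s)"] q0[OF that] by (simp add: q_def)
  have nz: "g (\<gamma> s) \<bullet> g x \<noteq> 0" if "0 \<le> s" "s \<le> a" for s
    using par[OF that] \<gamma>[OF that] gx by auto
  have "0 < g (\<gamma> a) \<bullet> g x"
  proof (rule ccontr)
    assume "\<not> ?thesis"
    moreover have "continuous_on {0..a} (\<lambda>s. g (\<gamma> s) \<bullet> g x)"
      by (intro continuous_intros continuous_on_compose2[OF g_cont cont]) (use \<gamma> in auto)
    ultimately obtain s where "0 \<le> s" "s \<le> a" "g (\<gamma> s) \<bullet> g x = 0"
      using IVT2'[of "\<lambda>s. g (\<gamma> s) \<bullet> g x" a 0 0] gx a by (auto simp: \<gamma>_def)
    then show False using nz by blast
  qed
  moreover have "g (\<gamma> a) = ((g (\<gamma> a) \<bullet> g x) / (g x \<bullet> g x)) *\<^sub>R g x"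
  proof -
    have "(g x \<bullet> g x) *\<^sub>R g (\<gamma> a) = (g x \<bullet> g x) *\<^sub>R (((g (\<gamma> a) \<bullet> g x) / (g x \<bullet> g x)) *\<^sub>R g x)"
      using par[of a] a gx by simp
    then show ?thesis using gx by (simp only: scaleR_cancel_left) auto
  qed
  ultimately show ?thesis using gx unfolding \<gamma>_def by (metis divide_pos_pos)
qed

lemma f_le_tangent:
  assumes x: "norm x < 1" "g x \<noteq> 0" and y: "norm y < 1" "(y - x) \<bullet> g x \<le> 0"
  shows "f y \<le> f x"
proof -
  have "((\<lambda>s. f (y + s *\<^sub>R (- g x))) \<longlongrightarrow> f (y + 0 *\<^sub>R (- g x))) (at_right 0)"
    using DERIV_isCont[OF f_along_line[of y 0 "- g x"]] y(1) by (simp add: isCont_def filterlim_at_split)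
  moreover have "\<forall>\<^sub>F s in at_right 0. f (y + s *\<^sub>R (- g x)) \<le> f x"
  proof -
    have "((\<lambda>s. norm (y + s *\<^sub>R (- g x))) \<longlongrightarrow> norm (y + 0 *\<^sub>R (- g x))) (at_right 0)"
      by (intro tendsto_intros)
    then have "\<forall>\<^sub>F s in at_right 0. norm (y + s *\<^sub>R (- g x)) < 1"
      using y(1) by (intro order_tendstoD(2)) auto
    moreover have "\<forall>\<^sub>F s :: real in at_right 0. 0 < s" by (simp add: eventually_at_right_less)
    ultimately show ?thesis
    proof eventually_elim
      case (elim s)
      have "0 < s * (g x \<bullet> g x)" using elim x by simp
      then have "(y + s *\<^sub>R (- g x) - x) \<bullet> g x < 0" using y(2) by (simp add: inner_simps)
      then show ?case using f_le_downhill[OF x elim(1)] by simp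
    qed
  qed
  ultimately show ?thesis by (intro tendsto_upperbound[of _ "f y"]) auto
qed

text \<open>By contact, \<open>f\<close> restricted to the tangent line has a maximum at
  \<open>x\<close>.\<close>
lemma tangential_Hessian_nonpos:
  assumes x: "norm x < 1" "g x \<noteq> 0"
  shows "tangential_Hessian x \<le> 0"
proof (rule ccontr)
  assume pos: "\<not> ?thesis"
  let ?\<tau> = "perp (g x)"
  have "0 < (?\<tau> v* H (x + 0 *\<^sub>R ?\<tau>)) \<bullet> ?\<tau>"
    using pos x unfolding tangential_Hessian_def by (simp add: dot_lmul_matrix zero_less_divide_iff divide_le_0_iff not_le)
  then obtain d where d: "0 < d" "\<And>h. 0 < h \<Longrightarrow> h < d \<Longrightarrow> g (x + 0 *\<^sub>R ?\<tau>) \<bullet> ?\<tau> < g (x + (0 + h) *\<^sub>R ?\<tau>) \<bullet> ?\<tau>"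
    using DERIV_pos_inc_right[OF g_along_line[of x 0 ?\<tau> ?\<tau>]] x by auto
  have "((\<lambda>s. norm (x + s *\<^sub>R ?\<tau>)) \<longlongrightarrow> norm (x + 0 *\<^sub>R ?\<tau>)) (at 0)" by (intro tendsto_intros)
  then have "\<forall>\<^sub>F s in at 0. norm (x + s *\<^sub>R ?\<tau>) < 1"
    using x by (intro order_tendstoD(2)) auto
  then obtain d' where d': "0 < d'" "\<And>s. s \<noteq> 0 \<Longrightarrow> \<bar>s\<bar> < d' \<Longrightarrow> norm (x + s *\<^sub>R ?\<tau>) < 1"
    unfolding eventually_at by (auto simp: dist_real_def)
  define h where "h = min d d' / 2"
  have h: "0 < h" "h < d" "h < d'" using d d' by (auto simp: h_def)
  have ins: "norm (x + s *\<^sub>R ?\<tau>) < 1" if "0 \<le> s" "s \<le> h" for s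
    using d'(2)[of s] x that h by (cases "s = 0") auto
  have "\<exists>z>0. z < h \<and> f (x + h *\<^sub>R ?\<tau>) - f (x + 0 *\<^sub>R ?\<tau>) = (h - 0) * (g (x + z *\<^sub>R ?\<tau>) \<bullet> ?\<tau>)"
    by (rule MVT2[OF h(1)]) (use ins in \<open>auto intro: f_along_line\<close>)
  then obtain z where z: "0 < z" "z < h" "f (x + h *\<^sub>R ?\<tau>) - f x = h * (g (x + z *\<^sub>R ?\<tau>) \<bullet> ?\<tau>)" by auto
  have "0 < h * (g (x + z *\<^sub>R ?\<tau>) \<bullet> ?\<tau>)" using d(2)[of z] z h by simp
  then have "f x < f (x + h *\<^sub>R ?\<tau>)" unfolding z(3)[symmetric] by simp
  moreover have "f (x + h *\<^sub>R ?\<tau>) \<le> f x" using ins[of h] h x by (intro f_le_tangent) auto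
  ultimately show False by simp
qed

section \<open>Downhill rays do not meet critical points\<close>

lemma gradient_derivative_tangential:
  assumes x: "norm x < 1" "g x \<noteq> 0" and v: "v = k *\<^sub>R perp (g x)"
  shows "v v* H x = tangential_Hessian x *\<^sub>R v"
proof -
  have "(g x \<bullet> g x) *\<^sub>R (v v* H x) = (g x \<bullet> g x) *\<^sub>R (tangential_Hessian x *\<^sub>R v)"
    unfolding gradient_derivative_diagonal(1)[OF x] by (simp add: v mult_ac)
  then show ?thesis using x(2) by (simp only: scaleR_cancel_left) auto
qed

lemma gradient_derivative_normal:
  assumes x: "norm x < 1" "g x \<noteq> 0" and v: "v = k *\<^sub>R g x"
  shows "v v* H x = normal_Hessian x *\<^sub>R v"
proof -
  have "(g x \<bullet> g x) *\<^sub>R (v v* H x) = (g x \<bullet> g x) *\<^sub>R (normal_Hessian x *\<^sub>R v)"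
    unfolding gradient_derivative_diagonal(1)[OF x] by (simp add: v mult_ac)
  then show ?thesis using x(2) by (simp only: scaleR_cancel_left) auto
qed

text \<open>The segment is compact and the regular points are open, so for nearby \<open>z\<close> the segment
  from \<open>z\<close> in the direction of its own gradient is regular as well.\<close>
lemma gradient_parallel_uphill_eventually:
  assumes s: "0 \<le> s" and reg: "\<And>r. 0 \<le> r \<Longrightarrow> r \<le> s \<Longrightarrow> y + r *\<^sub>R g y \<in> regular"
  shows "\<forall>\<^sub>F z in nhds y. g (z + s *\<^sub>R g z) \<bullet> perp (g z) = 0"
proof -
  let ?seg = "(\<lambda>r. y + r *\<^sub>R g y) ` {0..s}"
  have y: "norm y < 1" using reg[of 0] s by auto
  have "compact ?seg" by (intro compact_continuous_image continuous_intros) auto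
  moreover have "?seg \<subseteq> regular" using reg by auto
  ultimately obtain \<epsilon> where \<epsilon>: "0 < \<epsilon>" "(\<Union>x\<in>?seg. ball x \<epsilon>) \<subseteq> regular"
    using compact_subset_open_imp_ball_epsilon_subset[OF _ regular_open] by blast
  have "isCont g y" using has_derivative_continuous[OF g_deriv[OF y]] .
  then have "((\<lambda>z. norm (z - y) + s * norm (g z - g y)) \<longlongrightarrow> norm (y - y) + s * norm (g y - g y)) (nhds y)"
    by (intro tendsto_intros) (auto simp: continuous_at tendsto_nhds_iff[symmetric] filterlim_ident isCont_def tendsto_at_iff_tendsto_nhds)
  then have "\<forall>\<^sub>F z in nhds y. norm (z - y) + s * norm (g z - g y) < \<epsilon>"
    using \<epsilon>(1) by (intro order_tendstoD(2)) auto
  then show ?thesis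
  proof eventually_elim
    case (elim z)
    have "z + r *\<^sub>R g z \<in> regular" if r: "0 \<le> r" "r \<le> s" for r
    proof -
      have "norm ((z + r *\<^sub>R g z) - (y + r *\<^sub>R g y)) = norm ((z - y) + r *\<^sub>R (g z - g y))"
        by (simp add: algebra_simps)
      also have "\<dots> \<le> norm (z - y) + r * norm (g z - g y)"
        using norm_triangle_ineq[of "z - y" "r *\<^sub>R (g z - g y)"] r by simp
      also have "\<dots> \<le> norm (z - y) + s * norm (g z - g y)" using r by (simp add: mult_right_mono)
      finally have "z + r *\<^sub>R g z \<in> ball (y + r *\<^sub>R g y) \<epsilon>"
        using elim by (simp add: dist_norm norm_minus_commute)
      moreover have "y + r *\<^sub>R g y \<in> ?seg" using r by auto
      ultimately show ?thesis using \<epsilon>(2) by blast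
    qed
    then obtain \<rho> where "g (z + s *\<^sub>R g z) = \<rho> *\<^sub>R g z"
      using gradient_direction_constant[of "g z" 1 z s] s by auto
    then show ?case by simp
  qed
qed

text \<open>Differentiating, in the tangent direction, the identity that the gradients at \<open>z\<close> and
  at \<open>z + s *\<^sub>R g z\<close> are parallel. In terms of the curvatures \<open>\<kappa>\<close> of
  the level lines this says \<open>\<kappa>(y) = \<kappa>(x) (1 - a \<kappa>(y))\<close> at distance
  \<open>a\<close>: radii of curvature grow by the distance travelled downhill.\<close>
lemma tangential_Hessian_transport:
  assumes s: "0 \<le> s" and reg: "\<And>r. 0 \<le> r \<Longrightarrow> r \<le> s \<Longrightarrow> y + r *\<^sub>R g y \<in> regular"
    and \<rho>: "g (y + s *\<^sub>R g y) = \<rho> *\<^sub>R g y" "0 < \<rho>"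
  shows "(1 + s * tangential_Hessian y) * tangential_Hessian (y + s *\<^sub>R g y) = \<rho> * tangential_Hessian y"
proof -
  let ?x = "y + s *\<^sub>R g y" and ?\<tau> = "perp (g y)"
  have y: "norm y < 1" "g y \<noteq> 0" using reg[of 0] s by auto
  have x: "norm ?x < 1" "g ?x \<noteq> 0" using reg[of s] s by auto
  have G: "0 < g y \<bullet> g y" using y by simp
  note gy = g_deriv[OF y(1)]
  have inner: "((\<lambda>z. z + s *\<^sub>R g z) has_derivative (\<lambda>h. h + s *\<^sub>R (h v* H y))) (at y)"
    by (intro derivative_intros gy)
  have outer: "((\<lambda>z. g (z + s *\<^sub>R g z)) has_derivative (\<lambda>h. (h + s *\<^sub>R (h v* H y)) v* H ?x)) (at y)"
    by (rule has_derivative_compose[OF inner g_deriv[OF x(1)]])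
  have "((\<lambda>z. g (z + s *\<^sub>R g z) \<bullet> perp (g z)) has_derivative
      (\<lambda>h. g ?x \<bullet> perp (h v* H y) + ((h + s *\<^sub>R (h v* H y)) v* H ?x) \<bullet> ?\<tau>)) (at y)"
    by (rule has_derivative_inner[OF outer bounded_linear.has_derivative[OF bounded_linear_perp gy]])
  moreover have "((\<lambda>z. g (z + s *\<^sub>R g z) \<bullet> perp (g z)) has_derivative (\<lambda>h. 0)) (at y)"
  proof -
    have ev: "\<forall>\<^sub>F z in nhds y. g (z + s *\<^sub>R g z) \<bullet> perp (g z) = 0"
      by (rule gradient_parallel_uphill_eventually[OF s reg])
    show ?thesis
      by (rule has_derivative_transform_eventually[OF has_derivative_const[of 0]])
        (use ev in \<open>auto simp: eventually_at_filter \<rho>(1) elim: eventually_mono\<close>)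
  qed
  ultimately have "(\<lambda>h. g ?x \<bullet> perp (h v* H y) + ((h + s *\<^sub>R (h v* H y)) v* H ?x) \<bullet> ?\<tau>) = (\<lambda>h. 0)"
    by (rule has_derivative_unique)
  then have eq: "g ?x \<bullet> perp (?\<tau> v* H y) + ((?\<tau> + s *\<^sub>R (?\<tau> v* H y)) v* H ?x) \<bullet> ?\<tau> = 0"
    by (rule fun_cong)
  have 1: "?\<tau> v* H y = tangential_Hessian y *\<^sub>R ?\<tau>"
    by (rule gradient_derivative_tangential[OF y, of _ 1]) simp
  let ?h = "?\<tau> + s *\<^sub>R (?\<tau> v* H y)"
  have h: "?h = (1 + s * tangential_Hessian y) *\<^sub>R ?\<tau>" unfolding 1 by (simp add: algebra_simps)
  have 2: "?h v* H ?x = tangential_Hessian ?x *\<^sub>R ?h"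
  proof (rule gradient_derivative_tangential[OF x])
    show "?h = ((1 + s * tangential_Hessian y) / \<rho>) *\<^sub>R perp (g ?x)"
      unfolding h \<rho>(1) using \<rho>(2) by (simp add: perp_scaleR)
  qed
  have "g ?x \<bullet> perp (?\<tau> v* H y) = - \<rho> * tangential_Hessian y * (g y \<bullet> g y)"
    unfolding 1 \<rho>(1) by (simp add: perp_scaleR)
  moreover have "(?h v* H ?x) \<bullet> ?\<tau> = tangential_Hessian ?x * (1 + s * tangential_Hessian y) * (g y \<bullet> g y)"
    unfolding 2 unfolding h by simp
  ultimately have "(tangential_Hessian ?x * (1 + s * tangential_Hessian y) - \<rho> * tangential_Hessian y) * (g y \<bullet> g y) = 0"
    using eq by (simp add: algebra_simps)
  then show ?thesis using G by (simp add: mult.commute)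
qed

text \<open>Along a gradient line the length of the gradient changes at the rate \<open>H(n,n)\<close>, which
  is bounded by \<open>|H(t,t)|\<close> and hence by a multiple of that length. The curvature bound is asked
  for only as long as the line has stayed regular, so that it may be derived from facts about regular
  segments.\<close>
lemma regular_propagates:
  assumes x: "x \<in> regular" and e: "e = c *\<^sub>R g x" and b: "0 \<le> b"
    and inside: "\<And>s. 0 \<le> s \<Longrightarrow> s \<le> b \<Longrightarrow> norm (x + s *\<^sub>R e) < 1"
    and curv: "\<And>s. 0 \<le> s \<Longrightarrow> s \<le> b \<Longrightarrow> (\<And>r. 0 \<le> r \<Longrightarrow> r \<le> s \<Longrightarrow> x + r *\<^sub>R e \<in> regular) \<Longrightarrow>
      \<bar>tangential_Hessian (x + s *\<^sub>R e)\<bar> \<le> K * norm (g (x + s *\<^sub>R e))"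
  shows "x + b *\<^sub>R e \<in> regular"
proof (rule ccontr)
  assume "x + b *\<^sub>R e \<notin> regular"
  moreover have "continuous_on {0..b} (\<lambda>s. x + s *\<^sub>R e)" by (intro continuous_intros)
  ultimately obtain a where a: "0 < a" "a \<le> b" "x + a *\<^sub>R e \<notin> regular"
      "\<And>r. 0 \<le> r \<Longrightarrow> r < a \<Longrightarrow> x + r *\<^sub>R e \<in> regular"
    using first_exit[OF regular_open, of b "\<lambda>s. x + s *\<^sub>R e"] b x by auto
  have ga: "g (x + a *\<^sub>R e) = 0" using a inside[of a] by auto
  define v where "v s = g (x + s *\<^sub>R e) \<bullet> g x" for s
  define v' where "v' s = (e v* H (x + s *\<^sub>R e)) \<bullet> g x" for s
  have gx: "0 < norm (g x)" using x by auto
  define C where "C = \<bar>K\<bar> * \<bar>c\<bar> * norm (g x)"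
  have der: "(v has_real_derivative v' s) (at s)" if "0 \<le> s" "s \<le> a" for s
    using g_along_line[of x s e "g x"] inside[of s] that a unfolding v_def v'_def by simp
  have bound: "\<bar>v' s\<bar> \<le> C * \<bar>v s\<bar>" if s: "0 \<le> s" "s < a" for s
  proof -
    let ?y = "x + s *\<^sub>R e"
    have y: "norm ?y < 1" "g ?y \<noteq> 0" using a(4)[OF s] by auto
    obtain \<rho> where \<rho>: "0 < \<rho>" "g ?y = \<rho> *\<^sub>R g x"
      using gradient_direction_constant[OF e s(1)] a(4) s by auto
    have "e v* H ?y = normal_Hessian ?y *\<^sub>R e"
      by (rule gradient_derivative_normal[OF y, of _ "c / \<rho>"]) (use \<rho> e in simp)
    then have "v' s = normal_Hessian ?y * (c * (norm (g x))\<^sup>2)"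
      unfolding v'_def by (simp add: e power2_norm_eq_inner)
    then have "\<bar>v' s\<bar> = \<bar>normal_Hessian ?y\<bar> * (\<bar>c\<bar> * (norm (g x))\<^sup>2)" by (simp add: abs_mult)
    also have "\<dots> \<le> (\<bar>K\<bar> * (\<rho> * norm (g x))) * (\<bar>c\<bar> * (norm (g x))\<^sup>2)"
    proof (rule mult_right_mono)
      have "\<bar>tangential_Hessian ?y\<bar> \<le> K * norm (g ?y)"
        using s a by (intro curv) auto
      also have "\<dots> \<le> \<bar>K\<bar> * (\<rho> * norm (g x))" unfolding \<rho>(2) using \<rho>(1) by (simp add: mult_right_mono)
      finally show "\<bar>normal_Hessian ?y\<bar> \<le> \<bar>K\<bar> * (\<rho> * norm (g x))"
        using gradient_derivative_diagonal(2)[OF y] by linarith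
    qed simp
    also have "\<dots> = C * \<bar>v s\<bar>"
      unfolding C_def v_def \<rho>(2) using \<rho>(1) by (simp add: power2_norm_eq_inner[symmetric] power2_eq_square)
    finally show ?thesis .
  qed
  have "- ((v a)\<^sup>2 * exp (2 * C * a)) \<le> - ((v 0)\<^sup>2)"
  proof (rule le_at_right_end[of 0 a "\<lambda>s. - ((v s)\<^sup>2 * exp (2 * C * a))"])
    show "continuous_on {0..a} (\<lambda>s. - ((v s)\<^sup>2 * exp (2 * C * a)))"
      by (intro continuous_intros continuous_at_imp_continuous_on ballI DERIV_isCont[OF der]) auto
    show "- ((v s)\<^sup>2 * exp (2 * C * a)) \<le> - ((v 0)\<^sup>2)" if s: "0 < s" "s < a" for s
    proof -
      have "(v 0)\<^sup>2 \<le> (v s)\<^sup>2 * exp (2 * C * s)"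
        using s der bound by (intro gronwall_squares(2)[of s v v']) auto
      also have "\<dots> \<le> (v s)\<^sup>2 * exp (2 * C * a)"
        using s by (intro mult_left_mono) (auto simp: C_def intro!: mult_left_mono)
      finally show ?thesis by simp
    qed
  qed (rule a)
  then have "(v 0)\<^sup>2 \<le> 0" using ga by (simp add: v_def)
  then show False using gx by (simp add: v_def)
qed

text \<open>The curvature of the level lines is nonnegative and does not increase downhill, so its value at
  \<open>x\<close> bounds it along the whole ray.\<close>
lemma regular_downhill:
  assumes x: "x \<in> regular" and e: "e = - g x /\<^sub>R norm (g x)" and b: "0 \<le> b" and nb: "norm (x + b *\<^sub>R e) < 1"
  shows "x + b *\<^sub>R e \<in> regular"
proof (rule regular_propagates[OF x _ b, of e "- (1 / norm (g x))" "\<bar>tangential_Hessian x\<bar> / norm (g x)"])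
  have x1: "norm x < 1" "0 < norm (g x)" using x by auto
  show e': "e = - (1 / norm (g x)) *\<^sub>R g x" by (simp add: e divide_inverse)
  have ne: "norm e = 1" using x1 by (simp add: e)
  show ins: "norm (x + s *\<^sub>R e) < 1" if "0 \<le> s" "s \<le> b" for s
    using exit_time(3)[OF x1(1) ne] nb b that by (meson order_le_less_trans)
  show "\<bar>tangential_Hessian (x + s *\<^sub>R e)\<bar> \<le> \<bar>tangential_Hessian x\<bar> / norm (g x) * norm (g (x + s *\<^sub>R e))"
    if s: "0 \<le> s" "s \<le> b" and reg: "\<And>r. 0 \<le> r \<Longrightarrow> r \<le> s \<Longrightarrow> x + r *\<^sub>R e \<in> regular" for s
  proof -
    let ?y = "x + s *\<^sub>R e"
    have y: "norm ?y < 1" "g ?y \<noteq> 0" using reg[of s] s by auto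
    obtain \<rho> where \<rho>: "0 < \<rho>" "g ?y = \<rho> *\<^sub>R g x"
      using gradient_direction_constant[OF e' s(1) reg] by auto
    \<comment> \<open>\<open>x\<close> is reached from \<open>?y\<close> by moving uphill for the parameter \<open>t\<close>, as lines are parametrised by the gradient and not by arc length.\<close>
    define t where "t = s / norm (g ?y)"
    have up: "?y + r *\<^sub>R g ?y = x + (s - r * norm (g ?y)) *\<^sub>R e" for r
    proof -
      have "r *\<^sub>R g ?y = - (r * norm (g ?y)) *\<^sub>R e"
        unfolding \<rho>(2) using \<rho>(1) x1(2) by (simp add: e)
      then show ?thesis by (simp add: algebra_simps)
    qed
    have t: "0 \<le> t" "t * norm (g ?y) = s" using s y by (auto simp: t_def)
    have yt: "?y + t *\<^sub>R g ?y = x" unfolding up t(2) by simp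
    have regy: "?y + r *\<^sub>R g ?y \<in> regular" if r: "0 \<le> r" "r \<le> t" for r
    proof -
      have "r * norm (g ?y) \<le> t * norm (g ?y)" using r by (intro mult_right_mono) auto
      then show ?thesis unfolding up t(2) using r by (intro reg) auto
    qed
    have "g x = (1 / \<rho>) *\<^sub>R g ?y" using \<rho> by simp
    then have "(1 + t * tangential_Hessian ?y) * tangential_Hessian x = 1 / \<rho> * tangential_Hessian ?y"
      using tangential_Hessian_transport[OF t(1) regy, of "1 / \<rho>"] \<rho>(1) unfolding yt by simp
    then have tr: "tangential_Hessian ?y = \<rho> * (tangential_Hessian x + t * (tangential_Hessian ?y * tangential_Hessian x))"
      using \<rho>(1) by (simp add: field_simps)
    have "0 \<le> t * (tangential_Hessian ?y * tangential_Hessian x)"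
      using t(1) tangential_Hessian_nonpos[OF y] tangential_Hessian_nonpos[of x] x
      by (simp add: mult_nonpos_nonpos)
    then have "\<rho> * tangential_Hessian x \<le> \<rho> * (tangential_Hessian x + t * (tangential_Hessian ?y * tangential_Hessian x))"
      using \<rho>(1) by (intro mult_left_mono) auto
    then have "\<rho> * tangential_Hessian x \<le> tangential_Hessian ?y" using tr by linarith
    then have "\<bar>tangential_Hessian ?y\<bar> \<le> \<rho> * \<bar>tangential_Hessian x\<bar>"
      using tangential_Hessian_nonpos[OF y] tangential_Hessian_nonpos[of x] x \<rho>(1) by simp
    then show ?thesis unfolding \<rho>(2) using \<rho>(1) x1(2) by (simp add: mult.commute)
  qed
qed

section \<open>Downhill rays are radial\<close>

definition downhill :: "real^2 \<Rightarrow> real^2" where "downhill x = - g x /\<^sub>R norm (g x)"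

definition exit_point :: "real^2 \<Rightarrow> real^2" where
  "exit_point x = x + exit_time x (downhill x) *\<^sub>R downhill x"

lemma norm_downhill: "x \<in> regular \<Longrightarrow> norm (downhill x) = 1"
  by (simp add: downhill_def)

lemma g_downhill: "g x = - norm (g x) *\<^sub>R downhill x"
  by (cases "g x = 0") (simp_all add: downhill_def)

lemma downhill_ray:
  assumes x: "x \<in> regular" and s: "0 \<le> s" "s < exit_time x (downhill x)"
  shows "x + s *\<^sub>R downhill x \<in> regular"
    and "\<exists>\<rho>>0. g (x + s *\<^sub>R downhill x) = - \<rho> *\<^sub>R downhill x"
proof -
  have "norm x < 1" "0 < norm (g x)" using x by auto
  note ex = exit_time(3)[OF \<open>norm x < 1\<close> norm_downhill[OF x]]
  have reg: "x + r *\<^sub>R downhill x \<in> regular" if "0 \<le> r" "r \<le> s" for r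
    by (rule regular_downhill[OF x downhill_def]) (use ex[of r] that s in auto)
  then show "x + s *\<^sub>R downhill x \<in> regular" using s by simp
  have "downhill x = - (1 / norm (g x)) *\<^sub>R g x" by (simp add: downhill_def divide_inverse)
  from gradient_direction_constant[OF this s(1) reg] obtain \<rho> where \<rho>: "0 < \<rho>" "g (x + s *\<^sub>R downhill x) = \<rho> *\<^sub>R g x" by blast
  then have "g (x + s *\<^sub>R downhill x) = - (\<rho> * norm (g x)) *\<^sub>R downhill x"
    using arg_cong[OF g_downhill, of "\<lambda>v. \<rho> *\<^sub>R v" x] by simp
  then show "\<exists>\<rho>>0. g (x + s *\<^sub>R downhill x) = - \<rho> *\<^sub>R downhill x"
    using \<rho>(1) \<open>0 < norm (g x)\<close> by (metis mult_pos_pos)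
qed

lemma norm_exit_point: "x \<in> regular \<Longrightarrow> norm (exit_point x) = 1"
  unfolding exit_point_def using exit_time(2)[OF _ norm_downhill] by auto

text \<open>By contact at the points of the ray, \<open>f(y)\<close> is at most their values, which tend to
  \<open>0\<close>.\<close>
lemma f_nonpos_beyond_exit:
  assumes x: "x \<in> regular" and y: "norm y < 1" "0 < (y - exit_point x) \<bullet> downhill x"
  shows "f y \<le> 0"
proof -
  let ?e = "downhill x"
  let ?T = "exit_time x ?e"
  have nx: "norm x < 1" using x by auto
  note ex = exit_time[OF nx norm_downhill[OF x]]
  have ee: "?e \<bullet> ?e = 1" using norm_downhill[OF x] by (simp add: dot_square_norm)
  have "- f (x + ?T *\<^sub>R ?e) \<le> - f y"
  proof (rule le_at_right_end[of 0 ?T "\<lambda>s. - f (x + s *\<^sub>R ?e)"])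
    show "continuous_on {0..?T} (\<lambda>s. - f (x + s *\<^sub>R ?e))"
      using ex by (intro continuous_on_minus f_cont_along) (metis atLeastAtMost_iff less_eq_real_def)
    show "- f (x + s *\<^sub>R ?e) \<le> - f y" if s: "0 < s" "s < ?T" for s
    proof -
      let ?z = "x + s *\<^sub>R ?e"
      have z: "?z \<in> regular" using downhill_ray(1)[OF x] s by simp
      obtain \<rho> where \<rho>: "0 < \<rho>" "g ?z = - \<rho> *\<^sub>R ?e" using downhill_ray(2)[OF x, of s] s by auto
      have "(y - ?z) \<bullet> ?e = (y - exit_point x) \<bullet> ?e + (?T - s)"
        by (simp add: exit_point_def inner_simps ee)
      then have "0 < (y - ?z) \<bullet> ?e" using y(2) s by linarith
      then have "(y - ?z) \<bullet> g ?z < 0" unfolding \<rho>(2) using \<rho>(1) by (simp only: inner_scaleR_right) (simp add: mult_neg_pos)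
      then show ?thesis using f_le_downhill[of ?z y] z y by simp
    qed
  qed (rule ex)
  moreover have "f (x + ?T *\<^sub>R ?e) = 0" using ex(2) by (rule f_boundary)
  ultimately show ?thesis by simp
qed

text \<open>The second ray consists of points where \<open>f > 0\<close>, so it cannot enter the cap cut off
  at the exit point of the first.\<close>
lemma exit_points_monotone:
  assumes x: "x \<in> regular" and x': "x' \<in> regular"
  shows "(exit_point x' - exit_point x) \<bullet> downhill x \<le> 0"
proof -
  let ?e = "downhill x'"
  let ?T = "exit_time x' ?e"
  have nx: "norm x' < 1" using x' by auto
  note ex = exit_time[OF nx norm_downhill[OF x']]
  show ?thesis unfolding exit_point_def[of x']
  proof (rule le_at_right_end[of 0 ?T "\<lambda>s. (x' + s *\<^sub>R ?e - exit_point x) \<bullet> downhill x"])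
    show "(x' + s *\<^sub>R ?e - exit_point x) \<bullet> downhill x \<le> 0" if s: "0 < s" "s < ?T" for s
    proof (rule ccontr)
      have z: "x' + s *\<^sub>R ?e \<in> regular" using downhill_ray(1)[OF x'] s by simp
      assume "\<not> ?thesis"
      then have "f (x' + s *\<^sub>R ?e) \<le> 0" using z by (intro f_nonpos_beyond_exit[OF x]) auto
      moreover have "0 < f (x' + s *\<^sub>R ?e)" using z by (intro f_pos_regular) auto
      ultimately show False by simp
    qed
  qed (auto intro!: continuous_intros ex(1))
qed

lemma downhill_cont: "continuous_on regular downhill"
  unfolding downhill_def
  by (intro continuous_intros continuous_on_subset[OF g_cont]) auto

lemma exit_point_cont: "continuous_on regular exit_point"
  unfolding exit_point_def exit_time_def by (intro continuous_intros downhill_cont)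

text \<open>The difference of two unit vectors is perpendicular to their sum, so \<open>b' - b\<close> is a
  multiple \<open>k\<close> of \<open>perp (b + b')\<close>. The two inequalities bound the sign of
  \<open>k\<close> from both sides.\<close>
lemma unit_vectors_equal_if_monotone:
  fixes b b' e e' :: "real^2"
  assumes unit: "norm b = 1" "norm b' = 1"
    and mono: "(b' - b) \<bullet> e \<le> 0" "(b - b') \<bullet> e' \<le> 0"
    and sign: "0 < (e \<bullet> perp (b + b')) * (e' \<bullet> perp (b + b'))"
  shows "b' = b"
proof -
  let ?w = "b + b'"
  have "perp 0 = 0" by (simp add: vec_eq_real2)
  then have "?w \<noteq> 0" using sign by auto
  then have ww: "0 < ?w \<bullet> ?w" by simp
  have "(b' - b) \<bullet> ?w = 0"
    using unit by (simp add: inner_simps dot_square_norm inner_commute)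
  then have k: "(?w \<bullet> ?w) *\<^sub>R (b' - b) = ((b' - b) \<bullet> perp ?w) *\<^sub>R perp ?w"
    using perp_decomp[of ?w "b' - b"] by simp
  define k where "k = (b' - b) \<bullet> perp ?w"
  have "(?w \<bullet> ?w) * ((b' - b) \<bullet> e) = k * (e \<bullet> perp ?w)" for e
    using arg_cong[OF k, of "\<lambda>v. v \<bullet> e"] by (simp add: k_def inner_commute[of "perp ?w"] del: inner_add_left inner_add_right)
  note eq = this
  have "k * (e \<bullet> perp ?w) \<le> 0"
    unfolding eq[symmetric] using ww mono(1) by (simp add: mult_le_0_iff)
  moreover have "0 \<le> k * (e' \<bullet> perp ?w)"
    unfolding eq[symmetric] using ww mono(2) by (simp add: inner_simps zero_le_mult_iff)
  ultimately have "(k * (e \<bullet> perp ?w)) * (k * (e' \<bullet> perp ?w)) \<le> 0" by (rule mult_nonpos_nonneg)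
  then have "(k * k) * ((e \<bullet> perp ?w) * (e' \<bullet> perp ?w)) \<le> 0" by (simp add: mult_ac)
  moreover have "0 < (k * k) * ((e \<bullet> perp ?w) * (e' \<bullet> perp ?w))" if "k \<noteq> 0"
    using that by (intro mult_pos_pos[OF _ sign]) (auto simp: zero_less_mult_iff)
  ultimately have "k = 0" by linarith
  then show ?thesis using k ww unfolding k_def[symmetric] by simp
qed

text \<open>A ray meeting the circle obliquely allows nearby exit points on one side only, and the same side
  for nearby rays; two such points would each have to lie on the allowed side of the other.\<close>
lemma exit_point_locally_constant:
  assumes x: "x \<in> regular" and oblique: "downhill x \<bullet> perp (exit_point x) \<noteq> 0"
  shows "\<forall>\<^sub>F y in nhds x. y \<in> regular \<and> exit_point y = exit_point x"
proof -
  let ?b = exit_point and ?e = downhill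
  define S where "S y = (?e x \<bullet> perp (?b x + ?b y)) * (?e y \<bullet> perp (?b x + ?b y))" for y
  have "isCont ?e x" "isCont ?b x"
    using downhill_cont exit_point_cont x continuous_on_eq_continuous_at[OF regular_open] by blast+
  then have "isCont S x"
    unfolding S_def by (intro continuous_intros bounded_linear.isCont[OF bounded_linear_perp])
  then have lim: "(S \<longlongrightarrow> S x) (nhds x)" unfolding isCont_def tendsto_at_iff_tendsto_nhds .
  have dbl: "perp (?b x + ?b x) = 2 *\<^sub>R perp (?b x)" by (simp add: real2_simps)
  have "S x = 4 * (?e x \<bullet> perp (?b x))\<^sup>2" unfolding S_def dbl by (simp add: power2_eq_square)
  then have "0 < S x" using oblique by simp
  then have "\<forall>\<^sub>F y in nhds x. 0 < S y" using lim by (rule order_tendstoD(1)[rotated])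
  moreover have "\<forall>\<^sub>F y in nhds x. y \<in> regular" using regular_open x by (rule eventually_nhds_in_open)
  ultimately show ?thesis
  proof eventually_elim
    case (elim y)
    then show ?case
      using unit_vectors_equal_if_monotone[of "?b x" "?b y" "?e x" "?e y"]
        norm_exit_point x exit_points_monotone unfolding S_def by blast
  qed
qed

text \<open>Otherwise the rays of all nearby points lead to a common exit point. Compare \<open>x\<close> with
  a point \<open>y \<epsilon>\<close> on its tangent line: contact at \<open>x\<close> gives
  \<open>f (y \<epsilon>) \<le> f x\<close>, and contact at \<open>y \<epsilon>\<close> the converse, because
  the gradient there points away from the common exit point. So \<open>f\<close> is constant on the tangent
  line near \<open>x\<close>, although the gradients at these points other than \<open>x\<close> are not
  perpendicular to it.\<close>
lemma exit_point_perpendicular: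
  assumes x: "x \<in> regular"
  shows "downhill x \<bullet> perp (exit_point x) = 0"
proof (rule ccontr)
  assume oblique: "\<not> ?thesis"
  let ?t = "perp (g x)" and ?b = "exit_point x"
  have nx: "norm x < 1" "g x \<noteq> 0" using x by auto
  have te: "?t \<bullet> downhill x = 0" by (simp add: downhill_def)
  have tt: "0 < ?t \<bullet> ?t" using nx by simp
  define y where "y \<epsilon> = x + \<epsilon> *\<^sub>R ?t" for \<epsilon>
  have "((\<lambda>\<epsilon>. x + \<epsilon> *\<^sub>R ?t) \<longlongrightarrow> x + 0 *\<^sub>R ?t) (nhds 0)"
    by (intro tendsto_intros) (simp add: filterlim_ident)
  then have "(y \<longlongrightarrow> x) (nhds 0)" unfolding y_def by simp
  then have "\<forall>\<^sub>F \<epsilon> in nhds 0. y \<epsilon> \<in> regular \<and> exit_point (y \<epsilon>) = ?b"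
    by (rule eventually_compose_filterlim[OF exit_point_locally_constant[OF x oblique]])
  then obtain \<delta> where \<delta>: "0 < \<delta>" "\<And>\<epsilon>. \<bar>\<epsilon>\<bar> < \<delta> \<Longrightarrow> y \<epsilon> \<in> regular \<and> exit_point (y \<epsilon>) = ?b"
    unfolding eventually_nhds_metric by (auto simp: dist_real_def)
  have slope: "\<epsilon> * (?t \<bullet> g (y \<epsilon>)) > 0" if \<epsilon>: "\<epsilon> \<noteq> 0" "\<bar>\<epsilon>\<bar> < \<delta>" for \<epsilon>
  proof -
    note y = \<delta>(2)[OF \<epsilon>(2)]
    let ?e = "downhill (y \<epsilon>)"
    let ?T = "exit_time (y \<epsilon>) ?e" and ?R = "exit_time x (downhill x)"
    have T: "0 < ?T" using exit_time(1)[of "y \<epsilon>" ?e] y norm_downhill[of "y \<epsilon>"] by simp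
    have "y \<epsilon> + ?T *\<^sub>R ?e = x + ?R *\<^sub>R downhill x"
      using y unfolding exit_point_def by simp
    then have "?T *\<^sub>R ?e = ?R *\<^sub>R downhill x - \<epsilon> *\<^sub>R ?t" unfolding y_def by (simp add: algebra_simps)
    then have "?t \<bullet> (?T *\<^sub>R ?e) = - \<epsilon> * (?t \<bullet> ?t)" by (simp add: inner_simps te del: inner_perp)
    then have "?T * (?t \<bullet> ?e) = - \<epsilon> * (?t \<bullet> ?t)" by (simp only: inner_scaleR_right)
    then have *: "?t \<bullet> ?e = - \<epsilon> * (?t \<bullet> ?t) / ?T" using T by (simp only: eq_divide_eq mult.commute) simp
    have "?t \<bullet> g (y \<epsilon>) = - norm (g (y \<epsilon>)) * (?t \<bullet> ?e)"
      using arg_cong[OF g_downhill, of "\<lambda>v. ?t \<bullet> v" "y \<epsilon>"] by (simp only: inner_scaleR_right)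
    also have "\<dots> = \<epsilon> * (norm (g (y \<epsilon>)) * (?t \<bullet> ?t) / ?T)" unfolding * by simp
    finally have "\<epsilon> * (?t \<bullet> g (y \<epsilon>)) = \<epsilon>\<^sup>2 * (norm (g (y \<epsilon>)) * (?t \<bullet> ?t) / ?T)" by (simp add: power2_eq_square)
    moreover have "0 < norm (g (y \<epsilon>))" using y by simp
    ultimately show ?thesis using \<epsilon>(1) tt T by (simp del: inner_perp)
  qed
  have const: "f (y \<epsilon>) = f x" if \<epsilon>: "\<epsilon> \<noteq> 0" "\<bar>\<epsilon>\<bar> < \<delta>" for \<epsilon>
  proof (rule antisym)
    show "f (y \<epsilon>) \<le> f x" using \<delta>(2)[OF \<epsilon>(2)] nx by (intro f_le_tangent) (auto simp: y_def)
    have "(x - y \<epsilon>) \<bullet> g (y \<epsilon>) \<le> 0" using slope[OF \<epsilon>] by (simp add: y_def)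
    then show "f x \<le> f (y \<epsilon>)" using \<delta>(2)[OF \<epsilon>(2)] nx by (intro f_le_tangent) auto
  qed
  \<comment> \<open>At \<open>\<epsilon> = 0\<close> the gradient is perpendicular to the tangent line, so the contradiction needs some \<open>\<epsilon> \<noteq> 0\<close>.\<close>
  let ?m = "\<delta> / 2"
  have m: "0 < ?m" "?m < \<delta>" using \<delta>(1) by auto
  have "((\<lambda>s. f (x + s *\<^sub>R ?t)) has_real_derivative 0) (at ?m)"
  proof (rule has_field_derivative_transform_within_open[OF DERIV_const[of "f x"], of "{0<..<\<delta>}"])
    show "f x = f (x + s *\<^sub>R ?t)" if "s \<in> {0<..<\<delta>}" for s using const[of s] that by (simp add: y_def)
  qed (use m in auto)
  moreover have "((\<lambda>s. f (x + s *\<^sub>R ?t)) has_real_derivative g (y ?m) \<bullet> ?t) (at ?m)"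
    using f_along_line[of x ?m ?t] \<delta>(2)[of ?m] m unfolding y_def by auto
  ultimately have "g (y ?m) \<bullet> ?t = 0" by (metis DERIV_unique)
  then show False using slope[of ?m] m by (simp add: inner_commute)
qed

text \<open>The exit direction is plus or minus the exit point; an inward direction would put \<open>x\<close>
  outside the disc.\<close>
lemma exit_radially:
  assumes x: "x \<in> regular"
  shows "x = (1 - exit_time x (downhill x)) *\<^sub>R downhill x"
proof -
  let ?e = "downhill x" and ?b = "exit_point x" and ?T = "exit_time x (downhill x)"
  have ne: "norm ?e = 1" using norm_downhill[OF x] .
  have nx: "norm x < 1" using x by auto
  have T: "0 < ?T" using exit_time(1)[OF nx ne] .
  have "?b \<bullet> perp ?e = - (?e \<bullet> perp ?b)" by (simp add: real2_simps)
  then have "?b \<bullet> perp ?e = 0" using exit_point_perpendicular[OF x] by simp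
  then have be: "?b = (?b \<bullet> ?e) *\<^sub>R ?e"
    using perp_decomp[of ?e ?b] ne by (simp add: dot_square_norm)
  have "\<bar>?b \<bullet> ?e\<bar> = 1"
    using arg_cong[OF be, of norm] norm_exit_point[OF x] ne by simp
  then consider "?b \<bullet> ?e = 1" | "?b \<bullet> ?e = - 1" by linarith
  then show ?thesis
  proof cases
    case 1
    then have "?b = ?e" using be by simp
    then show ?thesis unfolding exit_point_def by (simp add: algebra_simps)
  next
    case 2
    then have "x + ?T *\<^sub>R ?e = - ?e" using be unfolding exit_point_def by simp
    then have "x = - ?e - ?T *\<^sub>R ?e" by (simp only: eq_diff_eq)
    also have "\<dots> = - (1 + ?T) *\<^sub>R ?e" by (simp add: algebra_simps)
    finally have "norm x = norm (- (1 + ?T) *\<^sub>R ?e)" by (rule arg_cong)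
    also have "\<dots> = 1 + ?T" unfolding norm_scaleR ne using T by simp
    finally show ?thesis using nx T by simp
  qed
qed

lemma gradient_radial:
  assumes "norm x < 1"
  shows "g x \<bullet> perp x = 0"
proof (cases "g x = 0")
  case False
  then have x: "x \<in> regular" using assms by simp
  have "perp x = (1 - exit_time x (downhill x)) *\<^sub>R perp (downhill x)"
    using exit_radially[OF x] by (metis perp_scaleR)
  then show ?thesis by (subst g_downhill) simp
qed simp

section \<open>Radial symmetry and monotonicity\<close>

text \<open>Along a circle around the origin the derivative of \<open>f\<close> is the product of
  \<open>g\<close> with the perpendicular of the position, which vanishes.\<close>
lemma f_radial:
  assumes "norm x = norm y" "norm x \<le> 1"
  shows "f x = f y"
proof (cases "norm x < 1")
  case True
  obtain t where t: "y = cos t *\<^sub>R x + sin t *\<^sub>R perp x" by (rule eq_rotation_of_equal_norm[OF assms(1)])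
  define R where "R a = cos a *\<^sub>R x + sin a *\<^sub>R perp x" for a
  have norm_R: "norm (R a) < 1" for a
  proof -
    have "R a \<bullet> R a = (cos a)\<^sup>2 * (x \<bullet> x) + (sin a)\<^sup>2 * (x \<bullet> x)"
      unfolding R_def by (simp add: inner_simps power2_eq_square)
    also have "\<dots> = ((cos a)\<^sup>2 + (sin a)\<^sup>2) * (x \<bullet> x)" by (simp only: distrib_right)
    finally have "R a \<bullet> R a = x \<bullet> x" by simp
    then have "norm (R a) = norm x" by (simp add: norm_eq)
    then show ?thesis using True by simp
  qed
  have "((\<lambda>a. f (R a)) has_real_derivative 0) (at a)" for a
  proof -
    have "(R has_derivative (\<lambda>h. (h * - sin a) *\<^sub>R x + (h * cos a) *\<^sub>R perp x)) (at a)"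
      unfolding R_def by (auto intro!: derivative_eq_intros)
    from has_derivative_compose[OF this f_deriv[OF norm_R]]
    have "((\<lambda>a. f (R a)) has_derivative (\<lambda>h. g (R a) \<bullet> ((h * - sin a) *\<^sub>R x + (h * cos a) *\<^sub>R perp x))) (at a)" .
    moreover have "(h * - sin a) *\<^sub>R x + (h * cos a) *\<^sub>R perp x = h *\<^sub>R perp (R a)" for h
      by (simp add: R_def real2_simps algebra_simps)
    ultimately show ?thesis by (simp add: gradient_radial[OF norm_R] has_field_derivative_def lambda_zero)
  qed
  then have "f (R t) = f (R 0)" by (intro DERIV_isconst_all) auto
  then show ?thesis using t by (simp add: R_def)
next
  case False
  then show ?thesis using assms f_boundary[of x] f_boundary[of y] by simp
qed

lemma gradient_radial_derivative:
  assumes x: "norm x < 1"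
  shows "(h v* H x) \<bullet> perp x + g x \<bullet> perp h = 0"
proof -
  have "((\<lambda>z. g z \<bullet> perp z) has_derivative (\<lambda>h. g x \<bullet> perp h + (h v* H x) \<bullet> perp x)) (at x)"
    by (rule has_derivative_inner[OF g_deriv[OF x] bounded_linear_imp_has_derivative[OF bounded_linear_perp]])
  moreover have "((\<lambda>z. g z \<bullet> perp z) has_derivative (\<lambda>h. 0)) (at x)"
    by (rule has_derivative_transform_within_open[OF has_derivative_const[of 0] open_ball, of x 0 1])
      (use x in \<open>auto simp: gradient_radial\<close>)
  ultimately have "(\<lambda>h. g x \<bullet> perp h + (h v* H x) \<bullet> perp x) = (\<lambda>h. 0)" by (rule has_derivative_unique)
  then show ?thesis by (metis add.commute)
qed

lemma gradient_origin: "g 0 = 0"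
proof -
  have "perp 0 = 0" by (simp add: vec_eq_real2)
  then have "g 0 \<bullet> g 0 = 0" using gradient_radial_derivative[of 0 "perp (g 0)"] by simp
  then show ?thesis by simp
qed

text \<open>A ray pointing inward would pass through the origin, which is critical.\<close>
lemma downhill_outward:
  assumes x: "x \<in> regular"
  shows "x = norm x *\<^sub>R downhill x" and "0 < norm x"
proof -
  let ?T = "exit_time x (downhill x)"
  have nx: "norm x < 1" "norm (downhill x) = 1" using x norm_downhill[OF x] by auto
  have "?T < 1"
  proof (rule ccontr)
    assume "\<not> ?thesis"
    then have "x + (?T - 1) *\<^sub>R downhill x \<in> regular" by (intro downhill_ray(1)[OF x]) auto
    moreover have "x + (?T - 1) *\<^sub>R downhill x = 0"
      by (subst (1) exit_radially[OF x]) (simp add: algebra_simps)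
    ultimately show False using gradient_origin by simp
  qed
  moreover have "norm x = \<bar>1 - ?T\<bar>"
    using arg_cong[OF exit_radially[OF x], of norm] nx by simp
  ultimately show "x = norm x *\<^sub>R downhill x" "0 < norm x" using exit_radially[OF x] by auto
qed

text \<open>For a radial function the second derivative along circles is the radial derivative divided by the
  radius.\<close>
lemma tangential_Hessian_radial_bound:
  assumes x: "x \<in> regular"
  shows "\<bar>tangential_Hessian x\<bar> * norm x \<le> norm (g x)"
proof -
  have nx: "norm x < 1" "g x \<noteq> 0" using x by auto
  have "perp x = (- norm x / norm (g x)) *\<^sub>R perp (g x)"
  proof -
    have "perp (g x) = perp (- norm (g x) *\<^sub>R downhill x)" by (rule arg_cong[OF g_downhill])
    also have "\<dots> = - norm (g x) *\<^sub>R perp (downhill x)" by (rule perp_scaleR)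
    finally have "perp (g x) = - norm (g x) *\<^sub>R perp (downhill x)" .
    moreover have "perp x = norm x *\<^sub>R perp (downhill x)"
      using arg_cong[OF downhill_outward(1)[OF x], of perp] perp_scaleR by simp
    ultimately show ?thesis using nx by simp
  qed
  then have "perp x v* H x = tangential_Hessian x *\<^sub>R perp x"
    by (rule gradient_derivative_tangential[OF nx])
  then have "tangential_Hessian x * (x \<bullet> x) = g x \<bullet> x"
    using gradient_radial_derivative[OF nx(1), of "perp x"] by simp
  then have "\<bar>tangential_Hessian x\<bar> * (norm x)\<^sup>2 = \<bar>g x \<bullet> x\<bar>"
    by (metis abs_mult abs_of_nonneg inner_ge_zero power2_norm_eq_inner)
  also have "\<dots> \<le> norm (g x) * norm x" by (rule Cauchy_Schwarz_ineq2)
  finally show ?thesis using downhill_outward(2)[OF x] by (simp add: power2_eq_square)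
qed

lemma slope_same_along_radii:
  assumes "norm u = 1" "norm w = 1" "0 \<le> s" "s < 1"
  shows "g (s *\<^sub>R u) \<bullet> u = g (s *\<^sub>R w) \<bullet> w"
proof (rule DERIV_unique)
  show "((\<lambda>s. f (s *\<^sub>R u)) has_real_derivative g (s *\<^sub>R u) \<bullet> u) (at s)"
    using f_along_line[of 0 s u] assms by simp
  have "((\<lambda>s. f (s *\<^sub>R w)) has_real_derivative g (s *\<^sub>R w) \<bullet> w) (at s)"
    using f_along_line[of 0 s w] assms by simp
  then show "((\<lambda>s. f (s *\<^sub>R u)) has_real_derivative g (s *\<^sub>R w) \<bullet> w) (at s)"
    by (rule has_field_derivative_transform_within_open[of _ _ _ "{-1<..<1}"])
      (use assms in \<open>auto intro!: f_radial\<close>)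
qed

text \<open>With \<open>g = 0\<close> throughout, \<open>f\<close> would be constant from \<open>p\<close> to
  the circle.\<close>
lemma regular_exists: "regular \<noteq> {}"
proof
  assume none: "regular = {}"
  obtain e :: "real^2" where e: "norm e = 1" using norm_axis_1 by blast
  let ?T = "exit_time p e"
  note ex = exit_time[OF p_disc e]
  have "f (p + ?T *\<^sub>R e) = f p"
  proof (rule f_const_along)
    show "g (p + s *\<^sub>R e) \<bullet> e = 0" if "0 \<le> s" "s < ?T" for s
      using ex(3)[of s] that none by auto
  qed (use ex in auto)
  then show False using f_boundary[OF ex(2)] fp_pos by simp
qed

text \<open>Start from some regular \<open>z\<close> and move along its radius to the point at distance
  \<open>norm x\<close>. Outward this is a downhill ray; inward the radial bound on the tangential second
  derivative has the constant \<open>1 / norm x\<close>. The derivative along a radius depends only on the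
  distance from the origin, so \<open>x\<close> cannot be critical.\<close>
lemma regular_if_nonzero:
  assumes x: "norm x < 1" "x \<noteq> 0"
  shows "x \<in> regular"
proof (rule ccontr)
  assume "x \<notin> regular"
  then have gx: "g x = 0" using x by simp
  obtain z where z: "z \<in> regular" using regular_exists by blast
  let ?u = "downhill z"
  have u: "norm ?u = 1" using norm_downhill[OF z] .
  have zu: "z = norm z *\<^sub>R ?u" "0 < norm z" using downhill_outward[OF z] by auto
  have nz: "norm z < 1" using z by auto
  let ?y = "norm x *\<^sub>R ?u"
  have "?y \<in> regular"
  proof (cases "norm z \<le> norm x")
    case True
    have eq: "z + (norm x - norm z) *\<^sub>R ?u = ?y"
      by (subst (1) zu(1)) (simp add: algebra_simps)
    show ?thesis unfolding eq[symmetric]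
      by (rule regular_downhill[OF z downhill_def]) (use True eq u x in auto)
  next
    case False
    have line: "z + s *\<^sub>R (- ?u) = (norm z - s) *\<^sub>R ?u" for s
      by (subst (1) zu(1)) (simp add: algebra_simps)
    have "z + (norm z - norm x) *\<^sub>R (- ?u) \<in> regular"
    proof (rule regular_propagates[OF z, of _ "1 / norm (g z)" _ "1 / norm x"])
      show "- ?u = (1 / norm (g z)) *\<^sub>R g z" by (simp add: downhill_def divide_inverse)
      show "norm (z + s *\<^sub>R (- ?u)) < 1" if "0 \<le> s" "s \<le> norm z - norm x" for s
      proof -
        have "0 \<le> norm z - s" using that norm_ge_zero[of x] by linarith
        then show ?thesis unfolding line using u that nz by simp
      qed
      show "\<bar>tangential_Hessian (z + s *\<^sub>R (- ?u))\<bar> \<le> 1 / norm x * norm (g (z + s *\<^sub>R (- ?u)))"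
        if s: "0 \<le> s" "s \<le> norm z - norm x" and reg: "\<And>r. 0 \<le> r \<Longrightarrow> r \<le> s \<Longrightarrow> z + r *\<^sub>R (- ?u) \<in> regular" for s
      proof -
        let ?v = "z + s *\<^sub>R (- ?u)"
        have "norm x \<le> norm ?v" unfolding line using u s by simp
        then have "\<bar>tangential_Hessian ?v\<bar> * norm x \<le> \<bar>tangential_Hessian ?v\<bar> * norm ?v"
          by (intro mult_left_mono) auto
        also have "\<dots> \<le> norm (g ?v)" using reg[of s] s by (intro tangential_Hessian_radial_bound) auto
        finally show ?thesis using x by (simp add: field_simps)
      qed
    qed (use False in simp)
    then show ?thesis unfolding line by simp
  qed
  then have "0 < norm (g ?y)" by simp
  have dy: "downhill ?y = ?u"
    using downhill_outward(1)[OF \<open>?y \<in> regular\<close>] u x by simp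
  have "g ?y \<bullet> ?u = - norm (g ?y)"
    using arg_cong[OF g_downhill[of ?y], of "\<lambda>v. v \<bullet> ?u"] u unfolding dy by (simp add: dot_square_norm)
  moreover have "g ?y \<bullet> ?u = g (norm x *\<^sub>R (x /\<^sub>R norm x)) \<bullet> (x /\<^sub>R norm x)"
    using u x by (intro slope_same_along_radii) auto
  ultimately show False using gx x \<open>0 < norm (g ?y)\<close> by simp
qed

lemma slope_negative:
  assumes u: "norm u = 1" and s: "0 < s" "s < 1"
  shows "g (s *\<^sub>R u) \<bullet> u < 0"
proof -
  have "u \<noteq> 0" using u by auto
  then have r: "s *\<^sub>R u \<in> regular" using u s by (intro regular_if_nonzero) auto
  have d: "downhill (s *\<^sub>R u) = u" using downhill_outward(1)[OF r] u s by simp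
  have "g (s *\<^sub>R u) \<bullet> u = - norm (g (s *\<^sub>R u))"
    using arg_cong[OF g_downhill[of "s *\<^sub>R u"], of "\<lambda>v. v \<bullet> u"] u unfolding d by (simp add: dot_square_norm)
  then show ?thesis using r by simp
qed

lemma f_strictly_decreasing:
  assumes "norm x < norm y" "norm y \<le> 1"
  shows "f y < f x"
proof -
  define u where "u = y /\<^sub>R norm y"
  have "0 < norm y" using assms(1) norm_ge_zero[of x] by linarith
  then have u: "norm u = 1" by (simp add: u_def)
  have cont: "continuous_on {norm x..norm y} (\<lambda>s. f (0 + s *\<^sub>R u))"
  proof (rule f_cont_along)
    show "norm (0 + s *\<^sub>R u) \<le> 1" if "s \<in> {norm x..norm y}" for s
      using that u assms(2) norm_ge_zero[of x] by (auto simp del: norm_ge_zero)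
  qed
  have "f (norm y *\<^sub>R u) < f (norm x *\<^sub>R u)"
  proof (rule DERIV_neg_imp_decreasing_open[OF assms(1)])
    fix s assume s: "norm x < s" "s < norm y"
    then have "0 < s" "s < 1" using norm_ge_zero[of x] assms(2) by linarith+
    then show "\<exists>d. ((\<lambda>s. f (s *\<^sub>R u)) has_real_derivative d) (at s) \<and> d < 0"
      using f_along_line[of 0 s u] slope_negative[OF u] u by auto
  qed (use cont in simp)
  moreover have "f (norm y *\<^sub>R u) = f y" "f (norm x *\<^sub>R u) = f x"
    using u assms by (auto intro!: f_radial)
  ultimately show ?thesis by simp
qed

end

section \<open>Extremal functions of class \<open>C\<^sup>3\<close>\<close>

lemma has_derivative_gradient:
  fixes f :: "real^2 \<Rightarrow> real"
  assumes "f differentiable (at x)"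
  shows "(f has_derivative (\<lambda>h. gradient f x \<bullet> h)) (at x)"
proof -
  let ?F = "frechet_derivative f (at x)"
  have d: "(f has_derivative ?F) (at x)" using assms frechet_derivative_works by blast
  then have lin: "linear ?F" using has_derivative_linear by blast
  have "?F h = gradient f x \<bullet> h" for h
  proof -
    have h: "h = h $ 1 *\<^sub>R axis 1 1 + h $ 2 *\<^sub>R axis 2 1" by (simp add: vec_eq_real2 axis_def)
    have "?F h = h $ 1 * ?F (axis 1 1) + h $ 2 * ?F (axis 2 1)"
      by (subst h) (simp only: linear_add[OF lin] linear_scale[OF lin] real_scaleR_def)
    then show ?thesis by (simp add: gradient_def partial_deriv_def inner_real2 mult.commute)
  qed
  then show ?thesis using d by (metis (no_types, lifting) ext)
qed

lemma disc_function_C3_0: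
  assumes "f \<in> C3_0 (ball 0 1)"
  shows "disc_function f (gradient f) (Hessian f)"
proof -
  have f: "continuous_on (cball 0 1) f" "\<And>x. norm x = 1 \<Longrightarrow> f x = 0" "C_k_on 3 (ball 0 1) f"
    using assms by (auto simp: C3_0_def frontier_ball)
  have d0: "f differentiable (at x)" and d1: "\<And>j. partial_deriv j f differentiable (at x)"
    and d2: "\<And>i j. partial_deriv i (partial_deriv j f) differentiable (at x)" if "norm x < 1" for x
    using f(3) that by (auto simp: numeral_3_eq_3)
  show ?thesis
  proof
    fix x :: "real^2" assume x: "norm x < 1"
    show "(f has_derivative (\<lambda>h. gradient f x \<bullet> h)) (at x)" by (rule has_derivative_gradient[OF d0[OF x]])
    show "(gradient f has_derivative (\<lambda>h. h v* Hessian f x)) (at x)"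
    proof (subst has_derivative_componentwise_within, rule ballI)
      fix b :: "real^2" assume "b \<in> Basis"
      then obtain j where b: "b = axis j 1" by (auto simp: Basis_vec_def)
      have "(partial_deriv j f has_derivative (\<lambda>h. gradient (partial_deriv j f) x \<bullet> h)) (at x)"
        by (rule has_derivative_gradient[OF d1[OF x]])
      moreover have "gradient (partial_deriv j f) x \<bullet> h = (h v* Hessian f x) $ j" for h
        by (simp add: gradient_def Hessian_def inner_real2 matrix_vector_real2 mult.commute)
      ultimately show "((\<lambda>x. gradient f x \<bullet> b) has_derivative (\<lambda>h. (h v* Hessian f x) \<bullet> b)) (at x)"
        by (simp add: b inner_axis gradient_def)
    qed
  next
    show "continuous_on (ball 0 1) (Hessian f)"
      unfolding Hessian_def
      by (intro continuous_on_vec_lambda continuous_at_imp_continuous_on ballI differentiable_imp_continuous_within d2) simp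
  qed (use f in auto)
qed

lemma disc_function_uminus:
  assumes "disc_function f g H"
  shows "disc_function (\<lambda>x. - f x) (\<lambda>x. - g x) (\<lambda>x. - H x)"
proof -
  interpret disc_function f g H by (rule assms)
  show ?thesis
  proof
    fix x :: "real^2" assume x: "norm x < 1"
    show "((\<lambda>x. - f x) has_derivative (\<lambda>h. - g x \<bullet> h)) (at x)"
      using has_derivative_minus[OF f_deriv[OF x]] by simp
    have "h v* (- H x) = - (h v* H x)" for h by (simp add: real2_simps)
    then show "((\<lambda>x. - g x) has_derivative (\<lambda>h. h v* (- H x))) (at x)"
      using has_derivative_minus[OF g_deriv[OF x]] by simp
  qed (auto intro!: continuous_on_minus H_cont f_cont simp: f_boundary)
qed

text \<open>The supremum of \<open>|f|\<close> is attained at some \<open>p\<close> in the disc. The sign of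
  \<open>f p\<close> is positive, since otherwise \<open>-f\<close> would be extremal, hence nonnegative,
  against \<open>f 0 = 1\<close>.\<close>
theorem corollary1p4:
  fixes D :: "(real^2) set" and f :: "real^2 \<Rightarrow> real"
  assumes D: "D = ball 0 1"
    and f: "f \<in> extremal_set D"
  shows "(\<exists>g :: real \<Rightarrow> real. \<forall>p\<in>closure D. f p = g (norm p)) \<and>
    (\<forall>p\<in>closure D. \<forall>q\<in>closure D. norm p < norm q \<longrightarrow> f q < f p) \<and>
    (\<forall>p\<in>closure D. 0 \<le> f p) \<and>
    (\<forall>p\<in>closure D. f p = 0 \<longleftrightarrow> (p $ 1)\<^sup>2 + (p $ 2)\<^sup>2 = 1) \<and>
    (\<forall>p\<in>D. norm (gradient f p) = 0 \<longrightarrow> p = 0)"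
proof -
  have C3: "f \<in> C3_0 (ball 0 1)" and f0: "f 0 = 1"
    and int: "set_integrable lebesgue (ball 0 1) (Hessian_norm f)"
    and sup: "(SUP p\<in>ball 0 1. \<bar>f p\<bar>) = 1 / (2 * pi) * (LINT p:ball 0 1|lebesgue. Hessian_norm f p)"
    using f unfolding D extremal_set_def by auto
  have norm_eq: "Hessian_norm f = (\<lambda>x. onorm ((*v) (Hessian f x)))" by (simp add: Hessian_norm_def fun_eq_iff)
  interpret disc_function f "gradient f" "Hessian f" by (rule disc_function_C3_0[OF C3])
  have "continuous_on (cball 0 1) (\<lambda>x. \<bar>f x\<bar>)" by (intro continuous_on_rabs f_cont)
  then obtain p where p: "p \<in> cball 0 1" "\<And>x. x \<in> cball 0 1 \<Longrightarrow> \<bar>f x\<bar> \<le> \<bar>f p\<bar>"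
    using continuous_attains_sup[of "cball (0::real^2) 1" "\<lambda>x. \<bar>f x\<bar>"] by auto
  have fp: "1 \<le> \<bar>f p\<bar>" using p(2)[of 0] f0 by simp
  then have np: "norm p < 1" using p(1) f_boundary[of p] by force
  have "(SUP p\<in>ball 0 1. \<bar>f p\<bar>) \<le> \<bar>f p\<bar>" by (rule cSUP_least) (use p(2) in auto)
  then have ext: "(LINT p:ball 0 1|lebesgue. onorm ((*v) (Hessian f p))) \<le> 2 * pi * \<bar>f p\<bar>"
    unfolding sup norm_eq by (simp add: field_simps)
  have "0 < f p"
  proof (rule ccontr)
    assume "\<not> 0 < f p"
    then have neg: "f p < 0" using fp by linarith
    have on: "onorm ((*v) (- Hessian f x)) = onorm ((*v) (Hessian f x))" for x
    proof -
      have "(*v) (- Hessian f x) = (\<lambda>v. - (Hessian f x *v v))" by (auto simp: real2_simps)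
      then show ?thesis by (simp add: onorm_neg)
    qed
    interpret minus: extremal_disc_function "\<lambda>x. - f x" "\<lambda>x. - gradient f x" "\<lambda>x. - Hessian f x" p
      by (intro extremal_disc_function.intro disc_function_uminus disc_function_C3_0[OF C3] extremal_disc_function_axioms.intro)
        (use neg np ext int in \<open>simp_all add: on norm_eq\<close>)
    show False using minus.f_nonneg[of 0] f0 by simp
  qed
  then interpret extremal_disc_function f "gradient f" "Hessian f" p
    using np ext int by unfold_locales (simp_all add: norm_eq)
  have cl: "closure D = cball 0 1" unfolding D by simp
  obtain e :: "real^2" where e: "norm e = 1" using norm_axis_1 by blast
  have radial: "\<forall>p\<in>closure D. f p = f (norm p *\<^sub>R e)"
    unfolding cl using e by (auto intro!: f_radial)
  have pos: "0 < f x" if "norm x < 1" for x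
    using f_strictly_decreasing[of x e] f_boundary[of e] that e by simp
  have zero: "f x = 0 \<longleftrightarrow> norm x = 1" if "norm x \<le> 1" for x
    using pos[of x] f_boundary[of x] that by force
  have sq: "(x $ 1)\<^sup>2 + (x $ 2)\<^sup>2 = 1 \<longleftrightarrow> norm x = 1" for x :: "real^2"
    by (simp add: norm_eq_sqrt_inner inner_real2 power2_eq_square)
  have "\<forall>p\<in>closure D. 0 \<le> f p"
    unfolding cl using pos zero by (metis less_eq_real_def mem_cball_0)
  moreover have "\<forall>p\<in>closure D. f p = 0 \<longleftrightarrow> (p $ 1)\<^sup>2 + (p $ 2)\<^sup>2 = 1"
    unfolding cl sq using zero by simp
  moreover have "\<forall>p\<in>D. norm (gradient f p) = 0 \<longrightarrow> p = 0"
    unfolding D using regular_if_nonzero by force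
  moreover have "\<forall>p\<in>closure D. \<forall>q\<in>closure D. norm p < norm q \<longrightarrow> f q < f p"
    unfolding cl using f_strictly_decreasing by simp
  ultimately show ?thesis using radial by (intro conjI exI[of _ "\<lambda>r. f (r *\<^sub>R e)"]) blast+
qed

end
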